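(* Let $k\ge2$ be a fixed integer and let $\alpha>\beta>0$ be fixed constants. For even $n$ let $p=\frac{\alpha\log n}{\binom{n-1}{k-1}}$, $q=\frac{\beta\log n}{\binom{n-1}{k-1}}$, and let $(\sigma,\mathcal{H})\sim\mathsf{HSBM}(n,p,q;k)$. Let $\widehat\Sigma(\mathcal{H})$ be the solution of the semidefinite program $$\text{maximize }\sum_{\{i,j\}\in\binom{V}{2}}w(ij)X_{ij}\quad\text{subject to}\quad \sum_{i,j\in V}X_{ij}=0,\quad X_{ii}=1\ \text{for all } i\in V,\quad X=X^T\succeq0,$$ where $w(ij)$ is the number of hyperedges of $\mathcal{H}$ containing both $i$ and $j$. Define $$I_{sdp}(\alpha,\beta)=\frac{k-1}{2^{2k}}\cdot\frac{(\alpha-\beta)^2}{\frac{k}{2^k}\alpha+\left(1-\frac{k}{2^k}\right)\beta}.$$ If $I_{sdp}(\alpha,\beta)>1$, then $\widehat\Sigma(\mathcal{H})=\sigma\sigma^T$ with probability $1-o(1)$ as $n\to\infty$.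
   Context: Model: let $n$ be an even positive integer, $V=\{1,\dots,n\}$, $\binom{V}{k}$ the collection of $k$-element subsets of $V$, and $p,q\in[0,1]$. The model $\mathsf{HSBM}(n,p,q;k)$ samples a pair $(\sigma,\mathcal{H})$ as follows. First $\sigma\in\{\pm1\}^V$ is chosen uniformly at random among vectors with equally many $+1$'s and $-1$'s. Then, given $\sigma$, $\mathcal{H}$ is a random $k$-uniform hypergraph on $V$ in which each $e=\{e_1,\dots,e_k\}\in\binom{V}{k}$ is a hyperedge independently, with probability $p$ if $\sigma_{e_1}=\cdots=\sigma_{e_k}$ and with probability $q$ otherwise. In the semidefinite program $X$ ranges over real $n\times n$ matrices and the constraint $\sum_{i,j\in V}X_{ij}=0$ is over all ordered pairs, including $i=j$. Asymptotics are as $n\to\infty$ along even integers with $k,\alpha,\beta$ fixed. *)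

theory Defs
  imports
    "HOL-Probability.Probability"
    "HOL-Library.Ramsey"
    "Jordan_Normal_Form.Matrix"
begin

text \<open>
  The vertex set is \<open>{..<n}\<close> rather than \<open>{1..n}\<close>, to agree with the indexing of matrices of
  type \<^typ>\<open>real mat\<close>.  The set of \<open>k\<close>-element subsets of \<open>V\<close> is \<open>nsets V k\<close>.
\<close>

definition balanced_labels :: "nat \<Rightarrow> (nat \<Rightarrow> real) set" where
  "balanced_labels n =
     {\<sigma> \<in> {..<n} \<rightarrow>\<^sub>E {1, -1}. card {i \<in> {..<n}. \<sigma> i = 1} = card {i \<in> {..<n}. \<sigma> i = -1}}"

definition monochromatic :: "(nat \<Rightarrow> real) \<Rightarrow> nat set \<Rightarrow> bool" where
  "monochromatic \<sigma> e \<longleftrightarrow> (\<forall>i\<in>e. \<forall>j\<in>e. \<sigma> i = \<sigma> j)"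

text \<open>
  A \<open>k\<close>-uniform hypergraph is represented by its set of hyperedges.  The definition is meant for
  even \<open>n\<close> and \<open>p, q\<close> in \<open>[0, 1]\<close>; \<^const>\<open>bernoulli_pmf\<close> clamps other parameters to \<open>[0, 1]\<close>.
\<close>

definition HSBM :: "nat \<Rightarrow> real \<Rightarrow> real \<Rightarrow> nat \<Rightarrow> ((nat \<Rightarrow> real) \<times> nat set set) pmf" where
  "HSBM n p q k =
     bind_pmf (pmf_of_set (balanced_labels n)) (\<lambda>\<sigma>.
       map_pmf (\<lambda>present. (\<sigma>, {e \<in> nsets {..<n} k. present e}))
         (Pi_pmf (nsets {..<n} k) False
           (\<lambda>e. bernoulli_pmf (if monochromatic \<sigma> e then p else q))))"

definition pair_weight :: "nat set set \<Rightarrow> nat \<Rightarrow> nat \<Rightarrow> nat" where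
  "pair_weight H i j = card {e \<in> H. i \<in> e \<and> j \<in> e}"

definition pos_semidef :: "real mat \<Rightarrow> bool" where
  "pos_semidef X \<longleftrightarrow>
     transpose_mat X = X \<and> (\<forall>v \<in> carrier_vec (dim_row X). 0 \<le> scalar_prod v (X *\<^sub>v v))"

definition sdp_feasible :: "nat \<Rightarrow> real mat \<Rightarrow> bool" where
  "sdp_feasible n X \<longleftrightarrow>
     X \<in> carrier_mat n n \<and>
     (\<Sum>i<n. \<Sum>j<n. X $$ (i, j)) = 0 \<and>
     (\<forall>i<n. X $$ (i, i) = 1) \<and>
     pos_semidef X"

text \<open>Each unordered pair of vertices is represented by \<open>(i, j)\<close> with \<open>i < j\<close>.\<close>

definition sdp_objective :: "nat \<Rightarrow> nat set set \<Rightarrow> real mat \<Rightarrow> real" where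
  "sdp_objective n H X = (\<Sum>j<n. \<Sum>i<j. real (pair_weight H i j) * X $$ (i, j))"

definition sdp_solutions :: "nat \<Rightarrow> nat set set \<Rightarrow> real mat set" where
  "sdp_solutions n H = {X. is_arg_max (sdp_objective n H) (sdp_feasible n) X}"

definition label_matrix :: "nat \<Rightarrow> (nat \<Rightarrow> real) \<Rightarrow> real mat" where
  "label_matrix n \<sigma> = mat n n (\<lambda>(i, j). \<sigma> i * \<sigma> j)"

definition edge_prob :: "nat \<Rightarrow> nat \<Rightarrow> real \<Rightarrow> real" where
  "edge_prob n k a = a * ln (real n) / real ((n - 1) choose (k - 1))"

definition I_sdp :: "nat \<Rightarrow> real \<Rightarrow> real \<Rightarrow> real" where
  "I_sdp k \<alpha> \<beta> =
     (real k - 1) / 2 ^ (2 * k) *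
     ((\<alpha> - \<beta>)\<^sup>2 / (real k / 2 ^ k * \<alpha> + (1 - real k / 2 ^ k) * \<beta>))"

end

theory Submission imports Defs "HOL-Real_Asymp.Real_Asymp" begin

text \<open>
  Let \<open>W\<close> be the matrix of pair weights with zero diagonal, \<open>d i = (\<Sum>j. W i j * \<sigma> i * \<sigma> j)\<close> the signed
  degrees and \<open>L = ln n\<close>. The signed Laplacian \<open>diag d - W\<close> vanishes at \<open>\<sigma>\<close>; if it is positive definite on
  the vectors orthogonal to \<open>1\<close> and \<open>\<sigma>\<close>, it certifies \<open>\<sigma>\<sigma>\<^sup>T\<close> as the unique optimum. The condition
  \<open>I_sdp > 1\<close> and a scalar Chernoff bound give \<open>d i > \<epsilon> * L\<close> for all \<open>i\<close>. It remains to bound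
  \<open>x\<^sup>T W x\<close> by less than \<open>\<epsilon> * L * \<bar>x\<bar>\<^sup>2\<close> for \<open>x\<close> orthogonal to \<open>1\<close> and \<open>\<sigma>\<close>. Matrix concentration is not
  precise enough on this scale and is replaced by three union bounds over scalar events: degrees are
  at most \<open>\<Delta> * L\<close>, every set \<open>T\<close> of at most \<open>2 * \<gamma> * n\<close> vertices carries weight at most \<open>\<eta> * L * card T\<close>,
  and the form of \<open>W - M\<close>, \<open>M\<close> the mean of \<open>W\<close>, is at most \<open>K * L * n\<close> at every sign vector.
\<close>

section \<open>The dual certificate\<close>

text \<open>A matrix Bernstein inequality bounds the fluctuation of the weights by a constant
  multiple of \<open>L\<close>, whereas \<open>\<epsilon>\<close> shrinks as \<open>I_sdp\<close>
  approaches 1, so every error has to be an arbitrarily small multiple of \<open>L\<close>. The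
  union bound over sign vectors achieves this: \<open>2 ^ n\<close> is negligible against tails of
  the form \<open>exp (- c * n * L)\<close>, so any \<open>K > 0\<close> is admissible. But it only
  reaches flat vectors, since rescaling to the cube costs a factor \<open>1 / \<gamma>\<close>. For
  vectors concentrated on few coordinates row sums are useless, because \<open>\<Delta>\<close> is
  large. There it helps that small vertex sets span little weight: every edge can be charged with
  factor \<open>\<kappa>\<close> to an end that carries few such edges and with
  \<open>1 / \<kappa>\<close> to the other. Hence \<open>\<kappa>\<close> is fixed from
  \<open>\<epsilon>\<close> and \<open>\<Delta>\<close>, \<open>\<eta>\<close> from
  \<open>\<kappa>\<close>, \<open>\<gamma>\<close> from \<open>\<eta>\<close>, and \<open>K\<close>
  from \<open>\<gamma>\<close>. Only the signed degrees use \<open>I_sdp > 1\<close>; for every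
  positive \<open>\<epsilon>\<close> the other events fail with vanishing probability.\<close>

lemma quadratic_form_insert:
  fixes X :: "'a \<Rightarrow> 'a \<Rightarrow> real"
  assumes "finite J" "a \<notin> J"
  shows "(\<Sum>i\<in>insert a J. \<Sum>j\<in>insert a J. X i j * u i * u j)
    = X a a * (u a)\<^sup>2 + u a * (\<Sum>j\<in>J. (X a j + X j a) * u j) + (\<Sum>i\<in>J. \<Sum>j\<in>J. X i j * u i * u j)"
proof -
  have "(\<Sum>i\<in>J. X i a * u i * u a) + (\<Sum>j\<in>J. X a j * u a * u j) = u a * (\<Sum>j\<in>J. (X a j + X j a) * u j)"
    unfolding sum_distrib_left sum.distrib[symmetric] by (intro sum.cong refl) (simp add: algebra_simps)
  then show ?thesis
    using assms by (simp add: sum.distrib power2_eq_square)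
qed

text \<open>One index is eliminated at a time, as in a Cholesky factorisation: the Schur complement
  of the pivot \<open>X a a\<close> is again positive semidefinite and supplies the remaining
  vectors. If the pivot is zero, its whole row vanishes and \<open>a\<close> contributes the zero
  vector.\<close>

lemma psd_gram:
  fixes X :: "'a \<Rightarrow> 'a \<Rightarrow> real"
  assumes "finite I"
    and "\<And>i j. i \<in> I \<Longrightarrow> j \<in> I \<Longrightarrow> X i j = X j i"
    and "\<And>u. 0 \<le> (\<Sum>i\<in>I. \<Sum>j\<in>I. X i j * u i * u j)"
  shows "\<exists>v :: 'a \<Rightarrow> 'a \<Rightarrow> real. \<forall>i\<in>I. \<forall>j\<in>I. X i j = (\<Sum>l\<in>I. v l i * v l j)"
  using assms
proof (induction I arbitrary: X rule: finite_induct)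
  case empty
  then show ?case by simp
next
  case (insert a I)
  note sym = insert.prems(1) and psd = insert.prems(2)
  have expand: "(\<Sum>i\<in>insert a I. \<Sum>j\<in>insert a I. X i j * u i * u j)
      = X a a * (u a)\<^sup>2 + 2 * u a * (\<Sum>j\<in>I. X a j * u j) + (\<Sum>i\<in>I. \<Sum>j\<in>I. X i j * u i * u j)" for u
  proof -
    have "(\<Sum>j\<in>I. (X a j + X j a) * u j) = 2 * (\<Sum>j\<in>I. X a j * u j)"
      unfolding sum_distrib_left by (intro sum.cong refl) (use sym[of a] in simp)
    then show ?thesis
      unfolding quadratic_form_insert[OF insert.hyps] by simp
  qed
  have Xaa: "X a a \<ge> 0"
  proof -
    have "(\<Sum>j\<in>I. X i j * (if j = a then 1 else 0)) = 0" for i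
      using insert.hyps by (intro sum.neutral) auto
    moreover have "(\<Sum>j\<in>I. X i j * c * (if j = a then 1 else 0)) = 0" for i c
      using insert.hyps by (intro sum.neutral) auto
    ultimately show ?thesis
      using psd[of "\<lambda>i. if i = a then 1 else 0"] unfolding expand by simp
  qed
  have psdI: "0 \<le> (\<Sum>i\<in>I. \<Sum>j\<in>I. (X i j - X a i * X a j / X a a) * u i * u j)" if "X a a \<noteq> 0" for u
  proof -
    define s where "s = (\<Sum>j\<in>I. X a j * u j)"
    \<comment> \<open>The value in coordinate \<open>a\<close> that minimises the form for fixed
      other coordinates; the minimum is the form of the Schur complement.\<close>
    define w where "w = u(a := - s / X a a)"
    have wI: "(\<Sum>j\<in>I. X a j * w j) = s"
      unfolding s_def w_def using insert.hyps by (intro sum.cong) auto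
    have wII: "(\<Sum>i\<in>I. \<Sum>j\<in>I. X i j * w i * w j) = (\<Sum>i\<in>I. \<Sum>j\<in>I. X i j * u i * u j)"
      unfolding w_def using insert.hyps by (intro sum.cong) auto
    have "0 \<le> X a a * (w a)\<^sup>2 + 2 * w a * s + (\<Sum>i\<in>I. \<Sum>j\<in>I. X i j * u i * u j)"
      using psd[of w] unfolding expand wI wII .
    also have "X a a * (w a)\<^sup>2 + 2 * w a * s = - (s * s / X a a)"
      using that by (simp add: w_def power2_eq_square field_simps)
    also have "s * s / X a a = (\<Sum>i\<in>I. \<Sum>j\<in>I. X a i * X a j / X a a * u i * u j)"
      unfolding s_def sum_product sum_divide_distrib by (intro sum.cong refl) (simp add: field_simps)
    finally show ?thesis
      by (simp add: algebra_simps sum_subtractf)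
  qed
  show ?case
  proof (cases "X a a = 0")
    case True
    have zero: "X a j = 0" if j: "j \<in> I" for j
    proof (rule ccontr)
      assume nz: "X a j \<noteq> 0"
      \<comment> \<open>With \<open>X a a = 0\<close> the form at \<open>t\<close> in coordinate
        \<open>a\<close> and 1 in coordinate \<open>j\<close> is affine in \<open>t\<close>; this
        choice gives it the value -1.\<close>
      define t where "t = - (X j j + 1) / (2 * X a j)"
      define u where "u = (\<lambda>i. if i = a then t else if i = j then 1 else (0::real))"
      have aj: "a \<noteq> j" using insert.hyps j by auto
      have uI: "(\<Sum>i\<in>I. c i * u i) = c j" for c
      proof -
        have "(\<Sum>i\<in>I. c i * u i) = (\<Sum>i\<in>I. if i = j then c i else 0)"
          using insert.hyps(2) by (intro sum.cong) (auto simp: u_def)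
        then show ?thesis using j insert.hyps by simp
      qed
      have "(\<Sum>i\<in>I. \<Sum>j\<in>I. X i j * u i * u j) = (\<Sum>i\<in>I. (\<Sum>j\<in>I. X i j * u j) * u i)"
        unfolding sum_distrib_right by (intro sum.cong refl) simp
      also have "\<dots> = X j j" unfolding uI by simp
      finally have "0 \<le> 2 * t * X a j + X j j"
        using psd[of u] unfolding expand uI using True by (simp add: u_def)
      also have "2 * t * X a j + X j j = -1" using nz by (simp add: t_def field_simps)
      finally show False by simp
    qed
    have "0 \<le> (\<Sum>i\<in>I. \<Sum>j\<in>I. X i j * u i * u j)" for u
    proof -
      have "(\<Sum>j\<in>I. X a j * u j) = 0" using zero by simp
      then show ?thesis using psd[of u] True unfolding expand by simp
    qed
    from insert.IH[of X, OF _ this] sym obtain v where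
      v: "\<forall>i\<in>I. \<forall>j\<in>I. X i j = (\<Sum>l\<in>I. v l i * v l j)" by auto
    define v' where "v' = (\<lambda>l i. if l = a \<or> i = a then 0 else (v l i :: real))"
    have "X i j = (\<Sum>l\<in>insert a I. v' l i * v' l j)" if "i \<in> insert a I" "j \<in> insert a I" for i j
    proof (cases "i = a \<or> j = a")
      case True
      then have "X i j = 0"
      proof
        assume "i = a" then show ?thesis using zero \<open>X a a = 0\<close> that by blast
      next
        assume "j = a" then show ?thesis using zero \<open>X a a = 0\<close> that sym[OF that] by auto
      qed
      then show ?thesis using True by (auto simp: v'_def)
    next
      case False
      have "(\<Sum>l\<in>insert a I. v' l i * v' l j) = (\<Sum>l\<in>I. v' l i * v' l j)"
        using insert.hyps by (simp add: v'_def)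
      also have "\<dots> = (\<Sum>l\<in>I. v l i * v l j)"
        using False insert.hyps by (intro sum.cong) (auto simp: v'_def)
      finally show ?thesis using v that False by auto
    qed
    then show ?thesis by blast
  next
    case False
    obtain v where v: "\<forall>i\<in>I. \<forall>j\<in>I. X i j - X a i * X a j / X a a = (\<Sum>l\<in>I. v l i * v l j)"
      using insert.IH[of "\<lambda>i j. X i j - X a i * X a j / X a a", OF _ psdI[OF False]] sym
      by (auto simp: mult.commute)
    define v' where "v' = (\<lambda>l i. if l = a then X a i / sqrt (X a a) else if i = a then 0 else (v l i :: real))"
    have "X i j = (\<Sum>l\<in>insert a I. v' l i * v' l j)" if "i \<in> insert a I" "j \<in> insert a I" for i j
    proof -
      have "(\<Sum>l\<in>insert a I. v' l i * v' l j) = X a i * X a j / X a a + (\<Sum>l\<in>I. v' l i * v' l j)"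
        using insert.hyps Xaa by (simp add: v'_def)
      also have "(\<Sum>l\<in>I. v' l i * v' l j) = (if i = a \<or> j = a then 0 else (\<Sum>l\<in>I. v l i * v l j))"
        using insert.hyps by (auto simp: v'_def intro!: sum.cong sum.neutral)
      finally have eq: "(\<Sum>l\<in>insert a I. v' l i * v' l j)
          = X a i * X a j / X a a + (if i = a \<or> j = a then 0 else (\<Sum>l\<in>I. v l i * v l j))" .
      show ?thesis
      proof (cases "i = a \<or> j = a")
        case True
        then show ?thesis using eq False sym[OF that] by auto
      next
        case noteq: False
        then have "X i j - X a i * X a j / X a a = (\<Sum>l\<in>I. v l i * v l j)" using v that by auto
        then show ?thesis using eq noteq by simp
      qed
    qed
    then show ?thesis by blast
  qed
qed

section \<open>Feasible matrices and the signed Laplacian\<close>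

lemma balanced_labels_sq:
  assumes "\<sigma> \<in> balanced_labels n" "i < n"
  shows "\<sigma> i * \<sigma> i = 1"
proof -
  have "\<sigma> i \<in> {1, -1}" using assms by (auto simp: balanced_labels_def PiE_iff)
  then show ?thesis by auto
qed

lemma balanced_labels_sum:
  assumes "\<sigma> \<in> balanced_labels n"
  shows "(\<Sum>i<n. \<sigma> i) = 0"
proof -
  have "\<sigma> i \<in> {1, -1}" if "i < n" for i
    using assms that by (auto simp: balanced_labels_def PiE_iff)
  then have "(\<Sum>i<n. \<sigma> i) = (\<Sum>i<n. (if \<sigma> i = 1 then 1 else 0) - (if \<sigma> i = -1 then 1 else 0))"
    by (intro sum.cong) fastforce+
  also have "\<dots> = real (card {i \<in> {..<n}. \<sigma> i = 1}) - real (card {i \<in> {..<n}. \<sigma> i = -1})"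
    by (simp add: sum_subtractf sum.If_cases Int_def)
  finally show ?thesis using assms by (simp add: balanced_labels_def)
qed

text \<open>On the diagonal \<open>pair_weight\<close> counts the hyperedges at a vertex. The
  objective does not see these entries, and with zeros there the form becomes affine in each
  coordinate.\<close>

definition offdiag_weight :: "nat set set \<Rightarrow> nat \<Rightarrow> nat \<Rightarrow> real" where
  "offdiag_weight H i j = (if i = j then 0 else real (pair_weight H i j))"

lemma offdiag_weight_sym: "offdiag_weight H i j = offdiag_weight H j i"
  by (auto simp: offdiag_weight_def pair_weight_def conj_commute)

lemma sum_lower_triangle:
  fixes f :: "nat \<Rightarrow> nat \<Rightarrow> real"
  assumes "\<And>i j. i < n \<Longrightarrow> j < n \<Longrightarrow> f i j = f j i"
  shows "2 * (\<Sum>j<n. \<Sum>i<j. f i j) = (\<Sum>i<n. \<Sum>j<n. if i = j then 0 else f i j)"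
  using assms
proof (induction n)
  case (Suc n)
  have 1: "(\<Sum>i<n. if i = n then 0 else f i n) = (\<Sum>i<n. f i n)"
    by (intro sum.cong) auto
  have "(\<Sum>j<n. if n = j then 0 else f n j) = (\<Sum>i<n. f i n)"
    by (intro sum.cong) (auto simp: Suc.prems)
  then show ?case
    using Suc by (simp add: sum.distrib 1)
qed simp

lemma sdp_objective_offdiag:
  assumes "\<And>i j. i < n \<Longrightarrow> j < n \<Longrightarrow> X $$ (i, j) = X $$ (j, i)"
  shows "2 * sdp_objective n H X = (\<Sum>i<n. \<Sum>j<n. offdiag_weight H i j * X $$ (i, j))"
  unfolding sdp_objective_def
  by (subst sum_lower_triangle)
     (auto simp: assms pair_weight_def conj_commute offdiag_weight_def intro!: sum.cong)

lemma label_matrix_feasible: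
  assumes "\<sigma> \<in> balanced_labels n"
  shows "sdp_feasible n (label_matrix n \<sigma>)"
proof -
  have "0 \<le> scalar_prod v (label_matrix n \<sigma> *\<^sub>v v)" if "v \<in> carrier_vec n" for v
  proof -
    have "scalar_prod v (label_matrix n \<sigma> *\<^sub>v v) = (\<Sum>i<n. vec_index v i * (\<Sum>j<n. \<sigma> i * \<sigma> j * vec_index v j))"
      using that by (simp add: label_matrix_def scalar_prod_def atLeast0LessThan)
    also have "\<dots> = (\<Sum>i<n. \<sigma> i * vec_index v i)\<^sup>2"
      unfolding power2_eq_square sum_product unfolding sum_distrib_left
      by (intro sum.cong refl) (simp add: mult_ac)
    finally show ?thesis by simp
  qed
  moreover have "(\<Sum>i<n. \<Sum>j<n. label_matrix n \<sigma> $$ (i, j)) = 0"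
    using balanced_labels_sum[OF assms]
    by (simp add: label_matrix_def flip: sum_distrib_left)
  ultimately show ?thesis
    using balanced_labels_sq[OF assms]
    by (auto simp: sdp_feasible_def pos_semidef_def label_matrix_def mult.commute intro!: eq_matI)
qed

text \<open>In terms of Gram vectors the constraint on the sum of all entries says that a sum of
  squares vanishes, so every Gram vector is orthogonal to \<open>1\<close>. The certificate
  therefore needs no positivity in that direction.\<close>

lemma sdp_feasible_gram:
  assumes "sdp_feasible n X"
  obtains v :: "nat \<Rightarrow> nat \<Rightarrow> real" where
    "\<And>i j. i < n \<Longrightarrow> j < n \<Longrightarrow> X $$ (i, j) = (\<Sum>l<n. v l i * v l j)"
    "\<And>l. l < n \<Longrightarrow> (\<Sum>i<n. v l i) = 0"
proof -
  have X: "X \<in> carrier_mat n n" and tr: "transpose_mat X = X"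
    and psd: "\<And>v. v \<in> carrier_vec n \<Longrightarrow> 0 \<le> scalar_prod v (X *\<^sub>v v)"
    and total: "(\<Sum>i<n. \<Sum>j<n. X $$ (i, j)) = 0"
    using assms by (auto simp: sdp_feasible_def pos_semidef_def)
  have sym: "X $$ (i, j) = X $$ (j, i)" if "i < n" "j < n" for i j
    using tr X that by (metis carrier_matD index_transpose_mat(1))
  have "0 \<le> (\<Sum>i<n. \<Sum>j<n. X $$ (i, j) * u i * u j)" for u
  proof -
    have "scalar_prod (vec n u) (X *\<^sub>v vec n u) = (\<Sum>i<n. u i * (\<Sum>j<n. X $$ (i, j) * u j))"
      using X by (simp add: scalar_prod_def atLeast0LessThan)
    also have "\<dots> = (\<Sum>i<n. \<Sum>j<n. X $$ (i, j) * u i * u j)"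
      unfolding sum_distrib_left by (intro sum.cong refl) simp
    finally show ?thesis using psd[of "vec n u"] by simp
  qed
  with psd_gram[of "{..<n}" "\<lambda>i j. X $$ (i, j)"] sym
  obtain v :: "nat \<Rightarrow> nat \<Rightarrow> real" where
    v: "\<And>i j. i < n \<Longrightarrow> j < n \<Longrightarrow> X $$ (i, j) = (\<Sum>l<n. v l i * v l j)"
    by auto
  have "0 = (\<Sum>i<n. \<Sum>j<n. \<Sum>l<n. v l i * v l j)"
    using total v by simp
  also have "\<dots> = (\<Sum>i<n. \<Sum>l<n. \<Sum>j<n. v l i * v l j)"
    by (intro sum.cong refl sum.swap)
  also have "\<dots> = (\<Sum>l<n. \<Sum>i<n. \<Sum>j<n. v l i * v l j)"
    by (rule sum.swap)
  also have "\<dots> = (\<Sum>l<n. (\<Sum>i<n. v l i)\<^sup>2)"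
    by (simp add: power2_eq_square sum_product)
  finally have "(\<Sum>l<n. (\<Sum>i<n. v l i)\<^sup>2) = 0" by simp
  then have "\<forall>l\<in>{..<n}. (\<Sum>i<n. v l i)\<^sup>2 = 0"
    by (subst (asm) sum_nonneg_eq_0_iff) auto
  then show thesis using v that by auto
qed

text \<open>
  The pairing of the signed Laplacian with a feasible \<open>X\<close> is twice the optimality gap; a Gram
  decomposition of \<open>X\<close> turns it into a sum of values of the quadratic form.
\<close>

lemma sdp_solutions_label_matrix:
  assumes \<sigma>: "\<sigma> \<in> balanced_labels n" and n: "n > 0"
    and pos: "\<And>x. (\<Sum>i<n. x i) = 0 \<Longrightarrow> (\<Sum>i<n. \<sigma> i * x i) = 0 \<Longrightarrow> \<exists>i<n. x i \<noteq> 0 \<Longrightarrow>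
      (\<Sum>i<n. \<Sum>j<n. offdiag_weight H i j * x i * x j)
        < (\<Sum>i<n. (\<Sum>j<n. offdiag_weight H i j * \<sigma> i * \<sigma> j) * (x i)\<^sup>2)"
  shows "sdp_solutions n H = {label_matrix n \<sigma>}"
proof -
  define W where "W = offdiag_weight H"
  define d where "d = (\<lambda>i. \<Sum>j<n. W i j * \<sigma> i * \<sigma> j)"
  define Q where "Q = (\<lambda>x. (\<Sum>i<n. d i * (x i)\<^sup>2) - (\<Sum>i<n. \<Sum>j<n. W i j * x i * x j))"
  have Wsym: "W i j = W j i" for i j unfolding W_def by (rule offdiag_weight_sym)
  have sq: "\<sigma> i * \<sigma> i = 1" if "i < n" for i using balanced_labels_sq[OF \<sigma> that] .
  \<comment> \<open>Only differences of the values \<open>\<sigma> i * x i\<close> occur, so adding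
    a multiple of \<open>\<sigma>\<close> to \<open>x\<close> changes nothing and \<open>x\<close>
    may be projected off \<open>\<sigma>\<close>.\<close>
  have Q_alt: "2 * Q x = (\<Sum>i<n. \<Sum>j<n. W i j * \<sigma> i * \<sigma> j * (\<sigma> i * x i - \<sigma> j * x j)\<^sup>2)" for x
  proof -
    have "(\<Sum>i<n. \<Sum>j<n. W i j * \<sigma> i * \<sigma> j * (\<sigma> i * x i - \<sigma> j * x j)\<^sup>2)
      = (\<Sum>i<n. \<Sum>j<n. W i j * \<sigma> i * \<sigma> j * (x i)\<^sup>2 + W j i * \<sigma> j * \<sigma> i * (x j)\<^sup>2
          - 2 * (W i j * x i * x j))"
    proof (intro sum.cong refl)
      fix i j assume ij: "i \<in> {..<n}" "j \<in> {..<n}"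
      have "W i j * \<sigma> i * \<sigma> j * (\<sigma> i * x i - \<sigma> j * x j)\<^sup>2
        = W i j * \<sigma> i * \<sigma> j * ((\<sigma> i * \<sigma> i) * (x i)\<^sup>2) + W i j * \<sigma> j * \<sigma> i * ((\<sigma> j * \<sigma> j) * (x j)\<^sup>2)
          - 2 * (W i j * (\<sigma> i * \<sigma> i) * (\<sigma> j * \<sigma> j) * x i * x j)"
        by (simp add: power2_eq_square algebra_simps)
      then show "W i j * \<sigma> i * \<sigma> j * (\<sigma> i * x i - \<sigma> j * x j)\<^sup>2
        = W i j * \<sigma> i * \<sigma> j * (x i)\<^sup>2 + W j i * \<sigma> j * \<sigma> i * (x j)\<^sup>2 - 2 * (W i j * x i * x j)"
        using sq ij Wsym[of i j] by simp
    qed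
    also have "\<dots> = (\<Sum>i<n. \<Sum>j<n. W i j * \<sigma> i * \<sigma> j * (x i)\<^sup>2)
        + (\<Sum>i<n. \<Sum>j<n. W j i * \<sigma> j * \<sigma> i * (x j)\<^sup>2)
        - 2 * (\<Sum>i<n. \<Sum>j<n. W i j * x i * x j)"
      by (simp add: sum.distrib sum_subtractf sum_distrib_left)
    also have "(\<Sum>i<n. \<Sum>j<n. W j i * \<sigma> j * \<sigma> i * (x j)\<^sup>2) = (\<Sum>i<n. \<Sum>j<n. W i j * \<sigma> i * \<sigma> j * (x i)\<^sup>2)"
      by (rule sum.swap)
    finally show ?thesis by (simp add: Q_def d_def sum_distrib_right)
  qed
  have Q_shift: "Q (\<lambda>i. x i - c * \<sigma> i) = Q x" for x c
  proof -
    have "\<sigma> i * (x i - c * \<sigma> i) - \<sigma> j * (x j - c * \<sigma> j) = \<sigma> i * x i - \<sigma> j * x j"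
      if "i < n" "j < n" for i j
    proof -
      have "\<sigma> m * (x m - c * \<sigma> m) = \<sigma> m * x m - c * (\<sigma> m * \<sigma> m)" for m
        by (simp add: algebra_simps)
      then show ?thesis using sq that by simp
    qed
    then have "2 * Q (\<lambda>i. x i - c * \<sigma> i) = 2 * Q x"
      unfolding Q_alt by (intro sum.cong refl) simp
    then show ?thesis by simp
  qed
  have sigma_sq: "(\<Sum>i<n. \<sigma> i * \<sigma> i) = real n" using sq by simp
  define c where "c = (\<lambda>x. (\<Sum>i<n. \<sigma> i * x i) / real n)"
  have Q_pos: "Q x > 0" if "(\<Sum>i<n. x i) = 0" and "\<exists>i<n. x i \<noteq> c x * \<sigma> i" for x
  proof -
    have "(\<Sum>i<n. x i - c x * \<sigma> i) = 0"
      using that(1) balanced_labels_sum[OF \<sigma>] by (simp add: sum_subtractf flip: sum_distrib_left)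
    moreover have "(\<Sum>i<n. \<sigma> i * (x i - c x * \<sigma> i)) = 0"
    proof -
      have "(\<Sum>i<n. \<sigma> i * (x i - c x * \<sigma> i)) = (\<Sum>i<n. \<sigma> i * x i) - c x * (\<Sum>i<n. \<sigma> i * \<sigma> i)"
        by (simp add: sum_subtractf sum_distrib_left algebra_simps)
      then show ?thesis using n by (simp add: sigma_sq c_def)
    qed
    ultimately have "Q (\<lambda>i. x i - c x * \<sigma> i) > 0"
      using pos[of "\<lambda>i. x i - c x * \<sigma> i"] that(2) by (auto simp: Q_def W_def d_def)
    then show ?thesis by (simp add: Q_shift)
  qed
  have Q_nonneg: "Q x \<ge> 0" if "(\<Sum>i<n. x i) = 0" for x
  proof (cases "\<exists>i<n. x i \<noteq> c x * \<sigma> i")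
    case True then show ?thesis using Q_pos that by fastforce
  next
    case False
    then have "Q (\<lambda>i. x i - c x * \<sigma> i) = 0" by (simp add: Q_def)
    then show ?thesis by (simp add: Q_shift)
  qed
  have objective_label: "2 * sdp_objective n H (label_matrix n \<sigma>) = (\<Sum>i<n. d i)"
    by (subst sdp_objective_offdiag) (auto simp: label_matrix_def d_def W_def mult_ac)
  have gap: "2 * (sdp_objective n H (label_matrix n \<sigma>) - sdp_objective n H X) \<ge> 0 \<and>
      (sdp_objective n H (label_matrix n \<sigma>) = sdp_objective n H X \<longrightarrow> X = label_matrix n \<sigma>)"
    if X: "sdp_feasible n X" for X
  proof -
    have diag: "X $$ (i, i) = 1" if "i < n" for i using X that by (simp add: sdp_feasible_def)
    obtain v where v: "\<And>i j. i < n \<Longrightarrow> j < n \<Longrightarrow> X $$ (i, j) = (\<Sum>l<n. v l i * v l j)"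
      and v0: "\<And>l. l < n \<Longrightarrow> (\<Sum>i<n. v l i) = 0"
      using sdp_feasible_gram[OF X] by blast
    have sumd: "(\<Sum>i<n. d i) = (\<Sum>l<n. \<Sum>i<n. d i * (v l i)\<^sup>2)"
    proof -
      have "(\<Sum>i<n. d i) = (\<Sum>i<n. d i * X $$ (i, i))" using diag by simp
      also have "\<dots> = (\<Sum>i<n. \<Sum>l<n. d i * (v l i)\<^sup>2)"
        by (intro sum.cong refl) (simp add: v sum_distrib_left power2_eq_square)
      also have "\<dots> = (\<Sum>l<n. \<Sum>i<n. d i * (v l i)\<^sup>2)"
        by (rule sum.swap)
      finally show ?thesis .
    qed
    have "2 * sdp_objective n H X = (\<Sum>i<n. \<Sum>j<n. W i j * X $$ (i, j))"
      unfolding W_def by (rule sdp_objective_offdiag) (simp add: v mult.commute)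
    also have "\<dots> = (\<Sum>i<n. \<Sum>j<n. \<Sum>l<n. W i j * v l i * v l j)"
      by (intro sum.cong refl) (simp add: v sum_distrib_left mult.assoc)
    also have "\<dots> = (\<Sum>i<n. \<Sum>l<n. \<Sum>j<n. W i j * v l i * v l j)"
      by (intro sum.cong refl sum.swap)
    also have "\<dots> = (\<Sum>l<n. \<Sum>i<n. \<Sum>j<n. W i j * v l i * v l j)"
      by (rule sum.swap)
    finally have eq: "2 * (sdp_objective n H (label_matrix n \<sigma>) - sdp_objective n H X) = (\<Sum>l<n. Q (v l))"
      using objective_label sumd by (simp add: Q_def sum_subtractf)
    \<comment> \<open>A zero gap forces every Gram vector to be a multiple of
      \<open>\<sigma>\<close>, hence \<open>X\<close> to be a multiple of the label matrix; the unit
      diagonal fixes the factor.\<close>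
    have "X = label_matrix n \<sigma>" if "(\<Sum>l<n. Q (v l)) = 0"
    proof -
      have "Q (v l) = 0" if "l < n" for l
        using \<open>(\<Sum>l<n. Q (v l)) = 0\<close> that Q_nonneg v0
        by (subst (asm) sum_nonneg_eq_0_iff) auto
      then have vl: "v l i = c (v l) * \<sigma> i" if "l < n" "i < n" for l i
        using Q_pos[OF v0[OF that(1)]] that by fastforce
      define t where "t = (\<Sum>l<n. c (v l) * c (v l))"
      have Xt: "X $$ (i, j) = t * (\<sigma> i * \<sigma> j)" if "i < n" "j < n" for i j
        unfolding v[OF that] t_def sum_distrib_right
        by (intro sum.cong refl) (use vl that in \<open>simp add: mult_ac\<close>)
      have "t = 1" using Xt[of 0 0] diag[of 0] sq[of 0] n by simp
      with Xt X show ?thesis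
        by (intro eq_matI) (auto simp: label_matrix_def sdp_feasible_def)
    qed
    moreover have "(\<Sum>l<n. Q (v l)) \<ge> 0" using Q_nonneg v0 by (intro sum_nonneg) auto
    ultimately show ?thesis using eq by auto
  qed
  show ?thesis
  proof (intro equalityI subsetI)
    fix X assume "X \<in> sdp_solutions n H"
    then have "sdp_feasible n X" and "\<not> sdp_objective n H X < sdp_objective n H (label_matrix n \<sigma>)"
      using label_matrix_feasible[OF \<sigma>] by (auto simp: sdp_solutions_def is_arg_max_def)
    then show "X \<in> {label_matrix n \<sigma>}" using gap[of X] by auto
  next
    fix X assume "X \<in> {label_matrix n \<sigma>}"
    then show "X \<in> sdp_solutions n H"
      using label_matrix_feasible[OF \<sigma>] gap by (fastforce simp: sdp_solutions_def is_arg_max_def)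
  qed
qed

section \<open>Upper bound for the quadratic form of the weights\<close>

text \<open>With zero diagonal the form is affine in each coordinate, so its maximum over the cube is
  attained at a vertex.\<close>

lemma quadratic_form_le_sign_vectors:
  fixes B :: "'a \<Rightarrow> 'a \<Rightarrow> real"
  assumes "finite I" and diag: "\<And>i. i \<in> I \<Longrightarrow> B i i = 0"
    and signs: "\<And>s. (\<forall>i\<in>I. s i \<in> {1, -1}) \<Longrightarrow> (\<Sum>i\<in>I. \<Sum>j\<in>I. B i j * s i * s j) \<le> K"
    and "\<forall>i\<in>I. \<bar>y i\<bar> \<le> 1"
  shows "(\<Sum>i\<in>I. \<Sum>j\<in>I. B i j * y i * y j) \<le> K"
  using assms(4)
proof (induction "card {i \<in> I. y i \<notin> {1, -1}}" arbitrary: y rule: less_induct)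
  case less
  show ?case
  proof (cases "\<exists>a\<in>I. y a \<notin> {1, -1}")
    case False
    then show ?thesis using signs[of y] by blast
  next
    case True
    then obtain a where a: "a \<in> I" "y a \<notin> {1, -1}" by blast
    define J where "J = I - {a}"
    have I: "I = insert a J" and J: "finite J" "a \<notin> J"
      using a assms(1) by (auto simp: J_def)
    define F where "F = (\<lambda>y. \<Sum>i\<in>I. \<Sum>j\<in>I. B i j * y i * y j)"
    define l where "l = (\<Sum>j\<in>J. (B a j + B j a) * y j)"
    define r where "r = (\<Sum>i\<in>J. \<Sum>j\<in>J. B i j * y i * y j)"
    have F_upd: "F (y(a := t)) = t * l + r" for t
    proof -
      have "(\<Sum>j\<in>J. (B a j + B j a) * (y(a := t)) j) = l"
        unfolding l_def using J by (intro sum.cong) auto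
      moreover have "(\<Sum>i\<in>J. \<Sum>j\<in>J. B i j * (y(a := t)) i * (y(a := t)) j) = r"
        unfolding r_def using J by (intro sum.cong) auto
      ultimately show ?thesis
        unfolding F_def I quadratic_form_insert[OF J] using diag[OF a(1)] by simp
    qed
    have F_le: "F (y(a := t)) \<le> K" if "t \<in> {1, -1}" for t
    proof -
      have "{i \<in> I. (y(a := t)) i \<notin> {1, -1}} \<subset> {i \<in> I. y i \<notin> {1, -1}}"
        using a that by (auto split: if_splits)
      then have "card {i \<in> I. (y(a := t)) i \<notin> {1, -1}} < card {i \<in> I. y i \<notin> {1, -1}}"
        using assms(1) by (intro psubset_card_mono) auto
      then show ?thesis
        unfolding F_def by (rule less.hyps) (use less.prems that in auto)
    qed
    have ya: "\<bar>y a\<bar> \<le> 1" using less.prems a by blast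
    \<comment> \<open>\<open>y\<close> is a convex combination of its modifications with 1 and -1 in
      coordinate \<open>a\<close>, and \<open>F\<close> is affine along that segment.\<close>
    have "F y = F (y(a := y a))" by simp
    also have "\<dots> = (1 + y a) / 2 * F (y(a := 1)) + (1 - y a) / 2 * F (y(a := -1))"
      unfolding F_upd by (simp add: field_simps)
    also have "\<dots> \<le> (1 + y a) / 2 * K + (1 - y a) / 2 * K"
      using F_le ya by (intro add_mono mult_left_mono) auto
    also have "\<dots> = K" by (simp add: field_simps)
    finally show ?thesis unfolding F_def .
  qed
qed

lemma weighted_am_gm:
  fixes a b \<kappa> :: real
  assumes "\<kappa> > 0"
  shows "2 * \<bar>a\<bar> * \<bar>b\<bar> \<le> a\<^sup>2 / \<kappa> + \<kappa> * b\<^sup>2"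
proof -
  have "0 \<le> (\<bar>a\<bar> - \<kappa> * \<bar>b\<bar>)\<^sup>2 / \<kappa>" using assms by simp
  also have "\<dots> = a\<^sup>2 / \<kappa> + \<kappa> * b\<^sup>2 - 2 * \<bar>a\<bar> * \<bar>b\<bar>"
    using assms by (simp add: power2_diff power_mult_distrib field_simps power2_eq_square)
  finally show ?thesis by simp
qed

text \<open>Peeling off vertices of small degree orients the edges with out-degree at most \<open>l\<close>; the
  weighted AM-GM inequality is then applied along the orientation.\<close>

lemma degenerate_quadratic_form_le:
  fixes W :: "'a \<Rightarrow> 'a \<Rightarrow> real"
  assumes "finite S" and W: "\<And>i j. W i j = W j i" "\<And>i j. W i j \<ge> 0" "\<And>i. W i i = 0"
    and "\<And>T. T \<subseteq> S \<Longrightarrow> T \<noteq> {} \<Longrightarrow> \<exists>v\<in>T. (\<Sum>j\<in>T. W v j) \<le> l"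
    and \<kappa>: "\<kappa> > 0"
  shows "(\<Sum>i\<in>S. \<Sum>j\<in>S. W i j * \<bar>u i\<bar> * \<bar>u j\<bar>)
    \<le> \<kappa> * l * (\<Sum>i\<in>S. (u i)\<^sup>2) + (\<Sum>i\<in>S. (\<Sum>j\<in>S. W i j) * (u i)\<^sup>2) / \<kappa>"
  using assms(1,5)
proof (induction S rule: finite_psubset_induct)
  case (psubset S)
  show ?case
  proof (cases "S = {}")
    case False
    then obtain v where v: "v \<in> S" "(\<Sum>j\<in>S. W v j) \<le> l" using psubset.prems by blast
    define R where "R = S - {v}"
    have S: "S = insert v R" and R: "finite R" "v \<notin> R" "R \<subset> S"
      using v psubset.hyps by (auto simp: R_def)
    have deg: "(\<Sum>j\<in>R. W v j) \<le> l" using v(2) R W by (simp add: S)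
    have "(\<Sum>i\<in>S. \<Sum>j\<in>S. W i j * \<bar>u i\<bar> * \<bar>u j\<bar>)
      = \<bar>u v\<bar> * (\<Sum>j\<in>R. (W v j + W j v) * \<bar>u j\<bar>) + (\<Sum>i\<in>R. \<Sum>j\<in>R. W i j * \<bar>u i\<bar> * \<bar>u j\<bar>)"
      unfolding S quadratic_form_insert[OF R(1,2)] using W by simp
    also have "\<bar>u v\<bar> * (\<Sum>j\<in>R. (W v j + W j v) * \<bar>u j\<bar>) = (\<Sum>j\<in>R. W v j * (2 * \<bar>u j\<bar> * \<bar>u v\<bar>))"
      unfolding sum_distrib_left using W(1) by (intro sum.cong) (auto simp: algebra_simps)
    \<comment> \<open>The edges from \<open>v\<close> into \<open>R\<close> charge
      \<open>\<kappa> * (u v)\<^sup>2\<close> to \<open>v\<close>, where their total weight is at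
      most \<open>l\<close>, and \<open>(u j)\<^sup>2 / \<kappa>\<close> to the other end, where the
      charges of the whole peeling add up to at most the degree.\<close>
    also have "\<dots> \<le> (\<Sum>j\<in>R. W v j * ((u j)\<^sup>2 / \<kappa> + \<kappa> * (u v)\<^sup>2))"
      by (intro sum_mono mult_left_mono weighted_am_gm W \<kappa>)
    also have "\<dots> = (\<Sum>j\<in>R. W v j * (u j)\<^sup>2) / \<kappa> + \<kappa> * (u v)\<^sup>2 * (\<Sum>j\<in>R. W v j)"
      unfolding sum_distrib_left sum_divide_distrib sum.distrib[symmetric]
      by (intro sum.cong refl) (simp add: algebra_simps)
    also have "\<kappa> * (u v)\<^sup>2 * (\<Sum>j\<in>R. W v j) \<le> \<kappa> * (u v)\<^sup>2 * l"
      using deg \<kappa> by (intro mult_left_mono) auto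
    also have "(\<Sum>i\<in>R. \<Sum>j\<in>R. W i j * \<bar>u i\<bar> * \<bar>u j\<bar>)
      \<le> \<kappa> * l * (\<Sum>i\<in>R. (u i)\<^sup>2) + (\<Sum>i\<in>R. (\<Sum>j\<in>R. W i j) * (u i)\<^sup>2) / \<kappa>"
      using psubset.IH[OF R(3)] psubset.prems R(3) by (meson order_trans psubset_imp_subset)
    finally have "(\<Sum>i\<in>S. \<Sum>j\<in>S. W i j * \<bar>u i\<bar> * \<bar>u j\<bar>)
      \<le> \<kappa> * l * ((u v)\<^sup>2 + (\<Sum>i\<in>R. (u i)\<^sup>2))
        + ((\<Sum>j\<in>R. W v j * (u j)\<^sup>2) + (\<Sum>i\<in>R. (\<Sum>j\<in>R. W i j) * (u i)\<^sup>2)) / \<kappa>"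
      by (simp add: algebra_simps add_divide_distrib)
    also have "(\<Sum>j\<in>R. W v j * (u j)\<^sup>2) + (\<Sum>i\<in>R. (\<Sum>j\<in>R. W i j) * (u i)\<^sup>2) = (\<Sum>i\<in>R. (\<Sum>j\<in>S. W i j) * (u i)\<^sup>2)"
      unfolding sum.distrib[symmetric] using R
      by (intro sum.cong) (simp_all add: S W(1)[of _ v] distrib_right)
    also have "\<dots> \<le> (\<Sum>i\<in>S. (\<Sum>j\<in>S. W i j) * (u i)\<^sup>2)"
      using W psubset.hyps R(3) by (intro sum_mono2 mult_nonneg_nonneg sum_nonneg) auto
    also have "(u v)\<^sup>2 + (\<Sum>i\<in>R. (u i)\<^sup>2) = (\<Sum>i\<in>S. (u i)\<^sup>2)"
      using R by (simp add: S)
    finally show ?thesis using \<kappa> by (simp add: divide_right_mono)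
  qed simp
qed

text \<open>Adding vertices of large degree one by one must stop before the set doubles, since otherwise
  it would be too dense.\<close>

lemma sparse_closure:
  fixes W :: "'a \<Rightarrow> 'a \<Rightarrow> real" and h :: real
  assumes "finite V" "S \<subseteq> V" and W: "\<And>i j. W i j = W j i" "\<And>i j. W i j \<ge> 0" "\<And>i. W i i = 0"
    and sparse: "\<And>T. T \<subseteq> V \<Longrightarrow> card T \<le> 2 * card S \<Longrightarrow> (\<Sum>i\<in>T. \<Sum>j\<in>T. W i j) \<le> h * card T"
    and h: "h > 0"
  obtains T where "S \<subseteq> T" "T \<subseteq> V" "card T \<le> 2 * card S" "\<And>j. j \<in> V - T \<Longrightarrow> (\<Sum>i\<in>T. W j i) \<le> 2 * h"
proof -
  \<comment> \<open>A vertex with weight above \<open>2 * h\<close> into \<open>T\<close> raises the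
    symmetric double sum by more than \<open>4 * h\<close>. A member of maximal cardinality is a
    point where the greedy extension stops.\<close>
  define \<F> where "\<F> = {T. S \<subseteq> T \<and> T \<subseteq> V \<and> card T \<le> 2 * card S \<and>
      4 * h * card (T - S) \<le> (\<Sum>i\<in>T. \<Sum>j\<in>T. W i j)}"
  have fin: "finite \<F>"
    by (rule finite_subset[of _ "Pow V"]) (use assms(1) in \<open>auto simp: \<F>_def\<close>)
  have "S \<in> \<F>" using assms(2) W by (auto simp: \<F>_def intro!: sum_nonneg)
  with fin obtain T where T: "T \<in> \<F>" and max: "\<And>T'. T' \<in> \<F> \<Longrightarrow> card T' \<le> card T"
    using Max_in[of "card ` \<F>"] Max_ge[of "card ` \<F>"]
    by (smt (verit) empty_iff finite_imageI imageE image_eqI image_is_empty)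
  have ST: "S \<subseteq> T" "T \<subseteq> V" "card T \<le> 2 * card S"
    and wT: "4 * h * card (T - S) \<le> (\<Sum>i\<in>T. \<Sum>j\<in>T. W i j)"
    using T by (auto simp: \<F>_def)
  have finT: "finite T" using ST assms(1) finite_subset by blast
  have "(\<Sum>i\<in>T. W j i) \<le> 2 * h" if j: "j \<in> V - T" for j
  proof (rule ccontr)
    assume large: "\<not> ?thesis"
    have "(\<Sum>a\<in>insert j T. \<Sum>b\<in>insert j T. W a b) = 2 * (\<Sum>i\<in>T. W j i) + (\<Sum>i\<in>T. \<Sum>j\<in>T. W i j)"
      using quadratic_form_insert[of T j W "\<lambda>_. 1"] j finT W by (simp add: sum_distrib_left)
    moreover have "insert j T - S = insert j (T - S)" "j \<notin> T - S" using j ST by auto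
    ultimately have w': "4 * h * card (insert j T - S) \<le> (\<Sum>a\<in>insert j T. \<Sum>b\<in>insert j T. W a b)"
      using wT large finT by (simp add: algebra_simps)
    have "card (insert j T) > card T" using j finT by simp
    then have "insert j T \<notin> \<F>" using max by fastforce
    then have "card (insert j T) > 2 * card S"
      using w' ST j by (auto simp: \<F>_def)
    \<comment> \<open>Having doubled, \<open>T\<close> would carry weight at least
      \<open>4 * h * card S\<close>, twice what sparsity allows.\<close>
    then have cT: "card T = 2 * card S" using ST j finT by simp
    have "S \<noteq> {}"
    proof
      assume "S = {}"
      then have "T = {}" using cT finT by simp
      then show False using large h by simp
    qed
    then have "card S > 0" using ST finT by (meson card_gt_0_iff finite_subset)
    moreover have "card (T - S) = card S"
      using card_Diff_subset[of S T] ST finT cT finite_subset by fastforce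
    ultimately have "h * card T < 4 * h * card (T - S)" using cT h by simp
    then show False using sparse[OF ST(2,3)] wT by linarith
  qed
  with ST that show thesis by blast
qed

text \<open>
  The coordinates of \<open>x\<close> are split at the level \<open>N / (\<gamma> n)\<close> of \<open>x\<^sub>i\<^sup>2\<close>. The few large ones, after
  closing up under high degree, see only a degenerate part of \<open>W\<close>, where AM-GM with a large
  parameter \<open>\<kappa>\<close> wins over the degree bound \<open>D\<close>; on the others the fluctuation \<open>W - M\<close>
  is controlled by its values at sign vectors.
\<close>

lemma quadratic_form_upper_bound:
  fixes W M :: "nat \<Rightarrow> nat \<Rightarrow> real" and n :: nat and \<gamma> h \<kappa> c D K :: real
  assumes W: "\<And>i j. W i j = W j i" "\<And>i j. W i j \<ge> 0" "\<And>i. W i i = 0"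
    and M0: "\<And>i. M i i = 0"
    and pos: "\<gamma> > 0" "h > 0" "\<kappa> > 0" "c \<ge> 0" "n > 0"
    and deg: "\<And>i. i < n \<Longrightarrow> (\<Sum>j<n. W i j) \<le> D"
    and sparse: "\<And>T. T \<subseteq> {..<n} \<Longrightarrow> real (card T) \<le> 2 * \<gamma> * n \<Longrightarrow> (\<Sum>i\<in>T. \<Sum>j\<in>T. W i j) \<le> h * card T"
    and mean: "\<And>y. (\<Sum>i<n. \<Sum>j<n. M i j * y i * y j) \<le> c * ((\<Sum>i<n. y i)\<^sup>2 + (\<Sum>i<n. \<sigma> i * y i)\<^sup>2)"
    and signs: "\<And>s. (\<forall>i\<in>{..<n}. s i \<in> {1, -1}) \<Longrightarrow> (\<Sum>i<n. \<Sum>j<n. (W i j - M i j) * s i * s j) \<le> K * n"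
    and \<sigma>: "\<And>i. i < n \<Longrightarrow> (\<sigma> i)\<^sup>2 = 1"
    and x: "(\<Sum>i<n. x i) = 0" "(\<Sum>i<n. \<sigma> i * x i) = 0"
  shows "(\<Sum>i<n. \<Sum>j<n. W i j * x i * x j) \<le> (K / \<gamma> + 4 * c * \<gamma> * n + 2 * D / \<kappa> + 3 * \<kappa> * h) * (\<Sum>i<n. (x i)\<^sup>2)"
proof (cases "\<forall>i<n. x i = 0")
  case True
  then show ?thesis by simp
next
  case False
  define N where "N = (\<Sum>i<n. (x i)\<^sup>2)"
  have N: "N > 0"
    unfolding N_def using False by (auto intro!: sum_pos2)
  \<comment> \<open>By Markov's inequality at most \<open>\<gamma> * n\<close> coordinates are this
    large, so a closure of twice the size stays within the range of the sparsity hypothesis.\<close>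
  define S where "S = {i\<in>{..<n}. \<gamma> * n * (x i)\<^sup>2 > N}"
  have cardS: "real (card S) \<le> \<gamma> * n"
  proof -
    have "real (card S) * N = (\<Sum>i\<in>S. N)" by simp
    also have "\<dots> \<le> (\<Sum>i\<in>S. \<gamma> * n * (x i)\<^sup>2)" by (intro sum_mono) (auto simp: S_def)
    also have "\<dots> \<le> (\<Sum>i<n. \<gamma> * n * (x i)\<^sup>2)"
      using pos by (intro sum_mono2) (auto simp: S_def)
    also have "\<dots> = \<gamma> * n * N" by (simp add: N_def sum_distrib_left)
    finally show ?thesis using N by simp
  qed
  obtain T where T: "S \<subseteq> T" "T \<subseteq> {..<n}" "card T \<le> 2 * card S"
      "\<And>j. j \<in> {..<n} - T \<Longrightarrow> (\<Sum>i\<in>T. W j i) \<le> 2 * h"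
  proof (rule sparse_closure[of "{..<n}" S W h])
    show "(\<Sum>i\<in>T. \<Sum>j\<in>T. W i j) \<le> h * card T" if "T \<subseteq> {..<n}" "card T \<le> 2 * card S" for T
      using that cardS by (intro sparse) linarith+
  qed (use W pos in \<open>auto simp: S_def\<close>)
  define U where "U = {..<n} - T"
  have finT: "finite T" using T(2) finite_subset by blast
  have cardT: "real (card T) \<le> 2 * \<gamma> * n" using T(3) cardS by linarith
  have split: "(\<Sum>i<n. f i) = (\<Sum>i\<in>T. f i) + (\<Sum>i\<in>U. f i)" for f :: "nat \<Rightarrow> real"
    unfolding U_def using sum.subset_diff[OF T(2), of f] by simp
  have NT: "(\<Sum>i\<in>T. (x i)\<^sup>2) \<le> N" and NU: "(\<Sum>i\<in>U. (x i)\<^sup>2) \<le> N"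
    unfolding N_def split[of "\<lambda>i. (x i)\<^sup>2"] by (simp_all add: sum_nonneg)
  have degT: "(\<Sum>j\<in>A. W i j) \<le> D" if "i < n" "A \<subseteq> {..<n}" for i A
    using deg[OF that(1)] sum_mono2[OF _ that(2), of "W i"] W(2) by force
  have D: "D \<ge> 0" using degT[of 0 "{}"] pos by simp

  have TT: "(\<Sum>i\<in>T. \<Sum>j\<in>T. W i j * x i * x j) \<le> (\<kappa> * h + D / \<kappa>) * N"
  proof -
    have avg: "\<exists>v\<in>T'. (\<Sum>j\<in>T'. W v j) \<le> h" if T': "T' \<subseteq> T" "T' \<noteq> {}" for T'
    proof (rule ccontr)
      assume contra: "\<not> ?thesis"
      have "card T' \<le> card T" using T' finT by (simp add: card_mono)
      then have "(\<Sum>i\<in>T'. \<Sum>j\<in>T'. W i j) \<le> h * card T'"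
        using T' T cardT by (intro sparse) auto
      moreover have "(\<Sum>i\<in>T'. h) < (\<Sum>i\<in>T'. \<Sum>j\<in>T'. W i j)"
        using contra T' finT finite_subset by (intro sum_strict_mono) auto
      ultimately show False by (simp add: mult.commute)
    qed
    have "(\<Sum>i\<in>T. \<Sum>j\<in>T. W i j * x i * x j) \<le> (\<Sum>i\<in>T. \<Sum>j\<in>T. W i j * \<bar>x i\<bar> * \<bar>x j\<bar>)"
      using W(2) by (intro sum_mono) (metis abs_ge_self abs_mult abs_of_nonneg)
    also have "\<dots> \<le> \<kappa> * h * (\<Sum>i\<in>T. (x i)\<^sup>2) + (\<Sum>i\<in>T. (\<Sum>j\<in>T. W i j) * (x i)\<^sup>2) / \<kappa>"
      using avg by (intro degenerate_quadratic_form_le finT W pos) auto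
    also have "(\<Sum>i\<in>T. (\<Sum>j\<in>T. W i j) * (x i)\<^sup>2) \<le> (\<Sum>i\<in>T. D * (x i)\<^sup>2)"
      using T(2) by (intro sum_mono mult_right_mono degT) auto
    also have "\<kappa> * h * (\<Sum>i\<in>T. (x i)\<^sup>2) + (\<Sum>i\<in>T. D * (x i)\<^sup>2) / \<kappa> = (\<kappa> * h + D / \<kappa>) * (\<Sum>i\<in>T. (x i)\<^sup>2)"
      by (simp add: algebra_simps sum_distrib_left sum_divide_distrib sum.distrib)
    also have "\<dots> \<le> (\<kappa> * h + D / \<kappa>) * N"
      using NT pos D by (intro mult_left_mono) auto
    finally show ?thesis using pos by (simp add: divide_right_mono)
  qed

  \<comment> \<open>Here \<open>\<kappa>\<close> goes to the vertices outside \<open>T\<close>,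
    which send weight at most \<open>2 * h\<close> into \<open>T\<close>, and
    \<open>1 / \<kappa>\<close> to those of \<open>T\<close>, for which only the degree bound is
    available.\<close>
  have TU: "2 * (\<Sum>i\<in>T. \<Sum>j\<in>U. W i j * x i * x j) \<le> (D / \<kappa> + 2 * \<kappa> * h) * N"
  proof -
    have "2 * (\<Sum>i\<in>T. \<Sum>j\<in>U. W i j * x i * x j) \<le> (\<Sum>i\<in>T. \<Sum>j\<in>U. W i j * ((x i)\<^sup>2 / \<kappa> + \<kappa> * (x j)\<^sup>2))"
      unfolding sum_distrib_left
    proof (intro sum_mono)
      fix i j
      have "2 * (x i * x j) \<le> 2 * \<bar>x i\<bar> * \<bar>x j\<bar>" by (simp flip: abs_mult)
      also have "\<dots> \<le> (x i)\<^sup>2 / \<kappa> + \<kappa> * (x j)\<^sup>2" by (rule weighted_am_gm[OF pos(3)])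
      finally have "W i j * (2 * (x i * x j)) \<le> W i j * ((x i)\<^sup>2 / \<kappa> + \<kappa> * (x j)\<^sup>2)"
        using W(2) by (rule mult_left_mono)
      then show "2 * (W i j * x i * x j) \<le> W i j * ((x i)\<^sup>2 / \<kappa> + \<kappa> * (x j)\<^sup>2)"
        by (simp add: mult_ac)
    qed
    also have "\<dots> = (\<Sum>i\<in>T. \<Sum>j\<in>U. W i j * ((x i)\<^sup>2 / \<kappa>)) + (\<Sum>i\<in>T. \<Sum>j\<in>U. W i j * (\<kappa> * (x j)\<^sup>2))"
      by (simp add: sum.distrib distrib_left)
    also have "(\<Sum>i\<in>T. \<Sum>j\<in>U. W i j * ((x i)\<^sup>2 / \<kappa>)) = (\<Sum>i\<in>T. (\<Sum>j\<in>U. W i j) * ((x i)\<^sup>2 / \<kappa>))"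
      by (simp only: sum_distrib_right)
    also have "\<dots> \<le> (\<Sum>i\<in>T. D * ((x i)\<^sup>2 / \<kappa>))"
      using T(2) pos by (intro sum_mono mult_right_mono degT) (auto simp: U_def)
    also have "(\<Sum>i\<in>T. \<Sum>j\<in>U. W i j * (\<kappa> * (x j)\<^sup>2)) = (\<Sum>j\<in>U. (\<Sum>i\<in>T. W j i) * (\<kappa> * (x j)\<^sup>2))"
      by (subst sum.swap) (simp add: sum_distrib_right W(1)[of _ "_::nat"])
    also have "\<dots> \<le> (\<Sum>j\<in>U. 2 * h * (\<kappa> * (x j)\<^sup>2))"
      using pos by (intro sum_mono mult_right_mono T(4)) (auto simp: U_def)
    also have "(\<Sum>i\<in>T. D * ((x i)\<^sup>2 / \<kappa>)) = D / \<kappa> * (\<Sum>i\<in>T. (x i)\<^sup>2)"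
      by (simp add: sum_distrib_left)
    also have "(\<Sum>j\<in>U. 2 * h * (\<kappa> * (x j)\<^sup>2)) = 2 * \<kappa> * h * (\<Sum>j\<in>U. (x j)\<^sup>2)"
      by (simp add: sum_distrib_left mult_ac)
    also have "D / \<kappa> * (\<Sum>i\<in>T. (x i)\<^sup>2) + 2 * \<kappa> * h * (\<Sum>j\<in>U. (x j)\<^sup>2) \<le> D / \<kappa> * N + 2 * \<kappa> * h * N"
      using NT NU pos D by (intro add_mono mult_left_mono) auto
    finally show ?thesis by (simp add: distrib_right)
  qed

  have UU: "(\<Sum>i\<in>U. \<Sum>j\<in>U. W i j * x i * x j) \<le> (K / \<gamma> + 4 * c * \<gamma> * n) * N"
  proof -
    define y where "y = (\<lambda>i. if i \<in> U then x i else 0)"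
    have restrict: "(\<Sum>i<n. f i * y i) = (\<Sum>i\<in>U. f i * x i)" for f :: "nat \<Rightarrow> real"
      unfolding split[of "\<lambda>i. f i * y i"] by (simp add: y_def U_def sum.neutral)
    have UU_y: "(\<Sum>i\<in>U. \<Sum>j\<in>U. W i j * x i * x j) = (\<Sum>i<n. \<Sum>j<n. W i j * y i * y j)"
    proof -
      have "(\<Sum>i<n. \<Sum>j<n. W i j * y i * y j) = (\<Sum>i<n. (\<Sum>j<n. W i j * y j) * y i)"
        unfolding sum_distrib_right by (intro sum.cong refl) (simp add: mult_ac)
      also have "\<dots> = (\<Sum>i\<in>U. (\<Sum>j\<in>U. W i j * x j) * x i)"
        unfolding restrict ..
      also have "\<dots> = (\<Sum>i\<in>U. \<Sum>j\<in>U. W i j * x i * x j)"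
        unfolding sum_distrib_right by (intro sum.cong refl) (simp add: mult_ac)
      finally show ?thesis by (rule sym)
    qed
    \<comment> \<open>No coordinate of \<open>y\<close> exceeds \<open>r\<close>, so
      \<open>y / r\<close> lies in the cube. Scaling back multiplies \<open>K * n\<close> by
      \<open>N / (\<gamma> * n)\<close>, which is the origin of the term
      \<open>K / \<gamma>\<close>.\<close>
    define r where "r = sqrt (N / (\<gamma> * n))"
    have r: "r > 0" "r\<^sup>2 = N / (\<gamma> * n)" using N pos by (simp_all add: r_def)
    have "\<bar>y i / r\<bar> \<le> 1" if "i < n" for i
    proof -
      have "(y i)\<^sup>2 \<le> N / (\<gamma> * n)"
      proof (cases "i \<in> U")
        case True
        then have "i \<notin> S" using T(1) by (auto simp: U_def)
        then have "\<gamma> * n * (x i)\<^sup>2 \<le> N" using that by (auto simp: S_def)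
        then show ?thesis using True pos by (simp add: y_def field_simps)
      next
        case False
        then show ?thesis using N pos by (simp add: y_def)
      qed
      then have "\<bar>y i\<bar> \<le> r" unfolding r_def by (metis real_sqrt_abs real_sqrt_le_mono)
      then show ?thesis using r by simp
    qed
    then have "\<forall>i\<in>{..<n}. \<bar>y i / r\<bar> \<le> 1" by blast
    then have "(\<Sum>i<n. \<Sum>j<n. (W i j - M i j) * (y i / r) * (y j / r)) \<le> K * n"
      by (rule quadratic_form_le_sign_vectors[OF finite_lessThan, of n "\<lambda>i j. W i j - M i j", rotated 2])
         (simp add: W(3) M0, rule signs)
    also have "(\<Sum>i<n. \<Sum>j<n. (W i j - M i j) * (y i / r) * (y j / r)) = (\<Sum>i<n. \<Sum>j<n. (W i j - M i j) * y i * y j) / r\<^sup>2"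
      by (simp add: sum_divide_distrib power2_eq_square)
    finally have fluct: "(\<Sum>i<n. \<Sum>j<n. (W i j - M i j) * y i * y j) \<le> K / \<gamma> * N"
      unfolding r(2) using N pos by (simp add: field_simps)
    \<comment> \<open>Cutting off \<open>T\<close> destroys the orthogonality of \<open>x\<close>
      only by the sum over \<open>T\<close>, which Cauchy-Schwarz bounds because \<open>T\<close> is
      small.\<close>
    have small: "(\<Sum>i<n. t i * y i)\<^sup>2 \<le> 2 * \<gamma> * n * N"
      if t: "\<And>i. i < n \<Longrightarrow> (t i)\<^sup>2 = 1" "(\<Sum>i<n. t i * x i) = 0" for t
    proof -
      have "(\<Sum>i<n. t i * y i) = - (\<Sum>i\<in>T. t i * x i)"
        using t(2) unfolding restrict split[of "\<lambda>i. t i * x i"] by simp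
      then have "(\<Sum>i<n. t i * y i)\<^sup>2 = (\<Sum>i\<in>T. t i * x i)\<^sup>2" by simp
      also have "\<dots> \<le> (\<Sum>i\<in>T. (t i)\<^sup>2) * (\<Sum>i\<in>T. (x i)\<^sup>2)" by (rule Cauchy_Schwarz_ineq_sum)
      also have "(\<Sum>i\<in>T. (t i)\<^sup>2) = card T"
      proof -
        have "(\<Sum>i\<in>T. (t i)\<^sup>2) = (\<Sum>i\<in>T. 1)" using T(2) t(1) by (intro sum.cong) auto
        then show ?thesis by simp
      qed
      also have "card T * (\<Sum>i\<in>T. (x i)\<^sup>2) \<le> 2 * \<gamma> * n * N"
        using NT cardT by (intro mult_mono) (auto intro: sum_nonneg)
      finally show ?thesis .
    qed
    have "(\<Sum>i<n. \<Sum>j<n. M i j * y i * y j) \<le> c * ((\<Sum>i<n. y i)\<^sup>2 + (\<Sum>i<n. \<sigma> i * y i)\<^sup>2)"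
      by (rule mean)
    also have "\<dots> \<le> c * (2 * \<gamma> * n * N + 2 * \<gamma> * n * N)"
      using small[of "\<lambda>_. 1"] small[of \<sigma>] x \<sigma> pos by (intro mult_left_mono add_mono) auto
    finally show ?thesis
      using fluct unfolding UU_y by (simp add: algebra_simps sum_subtractf)
  qed

  have UT: "(\<Sum>i\<in>U. \<Sum>j\<in>T. W i j * x i * x j) = (\<Sum>i\<in>T. \<Sum>j\<in>U. W i j * x i * x j)"
  proof (subst sum.swap, intro sum.cong refl)
    fix i j
    show "W j i * x j * x i = W i j * x i * x j" using W(1)[of i j] by simp
  qed
  have "(\<Sum>i<n. \<Sum>j<n. W i j * x i * x j) = (\<Sum>i\<in>T. \<Sum>j\<in>T. W i j * x i * x j)
      + 2 * (\<Sum>i\<in>T. \<Sum>j\<in>U. W i j * x i * x j) + (\<Sum>i\<in>U. \<Sum>j\<in>U. W i j * x i * x j)"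
    by (simp only: split sum.distrib UT)
  also have "\<dots> \<le> (\<kappa> * h + D / \<kappa>) * N + (D / \<kappa> + 2 * \<kappa> * h) * N + (K / \<gamma> + 4 * c * \<gamma> * n) * N"
    using TT TU UU by linarith
  also have "\<dots> = (K / \<gamma> + 4 * c * \<gamma> * n + 2 * D / \<kappa> + 3 * \<kappa> * h) * N"
    by (simp add: algebra_simps)
  finally show ?thesis unfolding N_def .
qed

section \<open>Chernoff bounds for fixed labels\<close>

text \<open>Markov's inequality for the exponential moment, with \<open>1 + x \<le> exp x\<close> in
  every factor. The Chernoff parameter is absorbed into \<open>c\<close> and \<open>t\<close>;
  negative \<open>c\<close> gives lower tails.\<close>

lemma bernoulli_sum_tail:
  fixes p c :: "'a \<Rightarrow> real"
  assumes "finite E" and p: "\<And>e. e \<in> E \<Longrightarrow> p e \<in> {0..1}"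
  shows "measure_pmf.prob (Pi_pmf E False (\<lambda>e. bernoulli_pmf (p e)))
      {X. t \<le> (\<Sum>e\<in>E. if X e then c e else 0)} \<le> exp ((\<Sum>e\<in>E. p e * (exp (c e) - 1)) - t)"
proof -
  define \<mu> where "\<mu> = Pi_pmf E False (\<lambda>e. bernoulli_pmf (p e))"
  define Y where "Y = (\<lambda>X. \<Sum>e\<in>E. if X e then c e else 0)"
  have Y_prod: "exp (Y X) = (\<Prod>e\<in>E. exp (if X e then c e else 0))" for X
    unfolding Y_def using assms(1) by (rule exp_sum)
  have "measure_pmf.expectation \<mu> (\<lambda>X. exp (Y X))
      = (\<Prod>e\<in>E. measure_pmf.expectation (bernoulli_pmf (p e)) (\<lambda>b. exp (if b then c e else 0)))"
    unfolding \<mu>_def Y_prod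
    by (rule expectation_prod_Pi_pmf)
       (use assms(1) in \<open>auto intro!: integrable_measure_pmf_finite\<close>)
  also have "\<dots> = (\<Prod>e\<in>E. 1 + p e * (exp (c e) - 1))"
    using p by (intro prod.cong refl) (simp add: algebra_simps)
  also have "\<dots> \<le> (\<Prod>e\<in>E. exp (p e * (exp (c e) - 1)))"
  proof (intro prod_mono conjI)
    fix e assume e: "e \<in> E"
    have "0 \<le> (1 - p e) + p e * exp (c e)"
      using p[OF e] by (intro add_nonneg_nonneg mult_nonneg_nonneg) auto
    then show "0 \<le> 1 + p e * (exp (c e) - 1)" by (simp add: algebra_simps)
    show "1 + p e * (exp (c e) - 1) \<le> exp (p e * (exp (c e) - 1))" by (rule exp_ge_add_one_self)
  qed
  also have "\<dots> = exp (\<Sum>e\<in>E. p e * (exp (c e) - 1))"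
    using assms(1) by (simp add: exp_sum)
  finally have mgf: "measure_pmf.expectation \<mu> (\<lambda>X. exp (Y X)) \<le> exp (\<Sum>e\<in>E. p e * (exp (c e) - 1))" .
  have "Y X \<le> (\<Sum>e\<in>E. \<bar>c e\<bar>)" for X
    unfolding Y_def by (intro sum_mono) auto
  then have int: "integrable (measure_pmf \<mu>) (\<lambda>X. exp (Y X))"
    by (intro measure_pmf.integrable_const_bound[where B = "exp (\<Sum>e\<in>E. \<bar>c e\<bar>)"]) auto
  have "measure_pmf.prob \<mu> {X. t \<le> Y X} = measure_pmf.prob \<mu> {X \<in> space (measure_pmf \<mu>). exp t \<le> exp (Y X)}"
    by simp
  also have "\<dots> \<le> measure_pmf.expectation \<mu> (\<lambda>X. exp (Y X)) / exp t"
    using int by (intro integral_Markov_inequality_measure[where A = "{}"]) auto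
  also have "\<dots> \<le> exp (\<Sum>e\<in>E. p e * (exp (c e) - 1)) / exp t"
    using mgf by (intro divide_right_mono) auto
  finally show ?thesis by (simp add: \<mu>_def Y_def exp_diff)
qed

text \<open>The difference of the two sides has derivative \<open>x - 1 + exp (- x)\<close>, which
  is nonnegative. The coefficient 1/2 matters: the bound is applied to monochromatic hyperedges, and
  with coefficient 1 the resulting exponent would fall below \<open>I_sdp\<close> for
  \<open>k > 2\<close>.\<close>

lemma exp_minus_le_quadratic:
  fixes x :: real
  assumes "x \<ge> 0"
  shows "exp (- x) \<le> 1 - x + x\<^sup>2 / 2"
proof -
  have "1 - 0 + 0\<^sup>2 / 2 - exp (- 0) \<le> 1 - x + x\<^sup>2 / 2 - exp (- x)"
  proof (rule DERIV_nonneg_imp_nondecreasing[OF assms])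
    fix y :: real
    show "\<exists>d. ((\<lambda>x. 1 - x + x\<^sup>2 / 2 - exp (- x)) has_real_derivative d) (at y) \<and> 0 \<le> d"
      using exp_ge_add_one_self[of "- y"]
      by (intro exI[of _ "- 1 + y + exp (- y)"] conjI) (auto intro!: derivative_eq_intros)
  qed
  then show ?thesis by simp
qed

text \<open>Serves where the exponent has no fixed sign. Its coefficient 1 is the source of the
  factor 2 in front of \<open>\<beta>\<close> in the final exponent.\<close>

lemma exp_le_quadratic:
  fixes x :: real
  assumes "\<bar>x\<bar> \<le> 1"
  shows "exp x \<le> 1 + x + x\<^sup>2"
proof (cases "x \<ge> 0")
  case True
  then show ?thesis using exp_bound[of x] assms by auto
next
  case False
  then have "exp x \<le> 1 + x + x\<^sup>2 / 2" using exp_minus_le_quadratic[of "- x"] by simp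
  also have "\<dots> \<le> 1 + x + x\<^sup>2" by simp
  finally show ?thesis .
qed

section \<open>Counting hyperedges, and weights as sums over hyperedges\<close>

text \<open>Removing \<open>B\<close> is a bijection onto the subsets of \<open>A - B\<close> of the
  complementary size. The case \<open>card B > k\<close> is separate because truncated subtraction
  would turn the binomial coefficient into 1.\<close>

lemma card_nsets_superset:
  assumes "finite A" "B \<subseteq> A"
  shows "card {e \<in> nsets A k. B \<subseteq> e} = (if card B \<le> k then (card A - card B) choose (k - card B) else 0)"
proof (cases "card B \<le> k")
  case True
  have finB: "finite B" using assms finite_subset by blast
  have "bij_betw (\<lambda>f. f \<union> B) {f. f \<subseteq> A - B \<and> card f = k - card B} {e \<in> nsets A k. B \<subseteq> e}"
  proof (rule bij_betw_byWitness[where f' = "\<lambda>e. e - B"])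
    show "(\<lambda>f. f \<union> B) ` {f. f \<subseteq> A - B \<and> card f = k - card B} \<subseteq> {e \<in> nsets A k. B \<subseteq> e}"
    proof safe
      fix f assume f: "f \<subseteq> A - B" "card f = k - card B"
      then have "finite f" "f \<inter> B = {}" using assms(1) finite_subset by blast+
      then have "card (f \<union> B) = k" using f finB True by (simp add: card_Un_disjoint)
      then show "f \<union> B \<in> nsets A k" using f assms \<open>finite f\<close> finB by (auto simp: nsets_def)
    qed
    show "(\<lambda>e. e - B) ` {e \<in> nsets A k. B \<subseteq> e} \<subseteq> {f. f \<subseteq> A - B \<and> card f = k - card B}"
      using finB by (auto simp: nsets_def card_Diff_subset)
  qed auto
  then have "card {e \<in> nsets A k. B \<subseteq> e} = card {f. f \<subseteq> A - B \<and> card f = k - card B}"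
    by (simp add: bij_betw_same_card)
  also have "\<dots> = card (A - B) choose (k - card B)"
    using assms(1) by (intro n_subsets) auto
  finally show ?thesis using True finB assms(2) by (simp add: card_Diff_subset)
next
  case False
  have "\<not> (B \<subseteq> e \<and> finite e \<and> card e = k)" for e
    using False card_mono[of e B] by auto
  then have "{e \<in> nsets A k. B \<subseteq> e} = {}" by (auto simp: nsets_def)
  then show ?thesis using False by (metis card.empty)
qed

text \<open>Adjacency matrix of the complete graph on \<open>e\<close>; the weight matrix is the sum
  of these over all hyperedges.\<close>

definition both_in :: "'a set \<Rightarrow> 'a \<Rightarrow> 'a \<Rightarrow> real" where
  "both_in e i j = (if i \<in> e \<and> j \<in> e \<and> i \<noteq> j then 1 else 0)"

lemma offdiag_weight_eq_sum:
  assumes "finite E"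
  shows "offdiag_weight {e \<in> E. X e} i j = (\<Sum>e\<in>E. if X e then both_in e i j else 0)"
proof (cases "i = j")
  case False
  have "(\<Sum>e\<in>E. if X e then both_in e i j else 0) = (\<Sum>e\<in>E. if X e \<and> i \<in> e \<and> j \<in> e then 1 else 0)"
    using False by (intro sum.cong) (auto simp: both_in_def)
  also have "\<dots> = real (card {e \<in> E. X e \<and> i \<in> e \<and> j \<in> e})"
    using assms by (simp add: sum.If_cases Int_def)
  finally show ?thesis using False by (simp add: offdiag_weight_def pair_weight_def)
qed (simp add: offdiag_weight_def both_in_def cong: if_cong)

text \<open>Exchanging the sums turns any linear functional of the weights into a weighted sum over
  independent hyperedges, as the exponential moment bound requires.\<close>

lemma offdiag_weight_form:
  assumes "finite E"
  shows "(\<Sum>i\<in>S. \<Sum>j\<in>T. offdiag_weight {e \<in> E. X e} i j * f i j)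
    = (\<Sum>e\<in>E. if X e then (\<Sum>i\<in>S. \<Sum>j\<in>T. both_in e i j * f i j) else 0)"
proof -
  have "(\<Sum>i\<in>S. \<Sum>j\<in>T. offdiag_weight {e \<in> E. X e} i j * f i j)
      = (\<Sum>i\<in>S. \<Sum>j\<in>T. \<Sum>e\<in>E. if X e then both_in e i j * f i j else 0)"
    unfolding offdiag_weight_eq_sum[OF assms] sum_distrib_right by (intro sum.cong refl) auto
  also have "\<dots> = (\<Sum>i\<in>S. \<Sum>e\<in>E. \<Sum>j\<in>T. if X e then both_in e i j * f i j else 0)"
    by (intro sum.cong refl sum.swap)
  also have "\<dots> = (\<Sum>e\<in>E. \<Sum>i\<in>S. \<Sum>j\<in>T. if X e then both_in e i j * f i j else 0)"
    by (rule sum.swap)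
  also have "\<dots> = (\<Sum>e\<in>E. if X e then (\<Sum>i\<in>S. \<Sum>j\<in>T. both_in e i j * f i j) else 0)"
    by (intro sum.cong refl) auto
  finally show ?thesis .
qed

lemma both_in_form_le:
  assumes "finite e" "card e \<le> k" "finite T" and f: "\<And>i j. i \<in> T \<Longrightarrow> j \<in> T \<Longrightarrow> \<bar>f i j\<bar> \<le> (1::real)"
  shows "\<bar>\<Sum>i\<in>T. \<Sum>j\<in>T. both_in e i j * f i j\<bar> \<le> real k ^ 2"
proof -
  have "\<bar>\<Sum>i\<in>T. \<Sum>j\<in>T. both_in e i j * f i j\<bar> \<le> (\<Sum>i\<in>T. \<Sum>j\<in>T. \<bar>both_in e i j * f i j\<bar>)"
    by (intro order_trans[OF sum_abs] sum_mono sum_abs)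
  also have "\<dots> \<le> (\<Sum>i\<in>T. \<Sum>j\<in>T. (if i \<in> e then 1 else 0) * (if j \<in> e then 1 else 0))"
    using f by (intro sum_mono) (auto simp: both_in_def abs_mult)
  also have "\<dots> = (\<Sum>i\<in>T. if i \<in> e then 1 else 0) * (\<Sum>j\<in>T. if j \<in> e then 1 else 0)"
    by (simp add: sum_product)
  also have "\<dots> = real (card (T \<inter> e)) * real (card (T \<inter> e))"
    using assms(3) by (simp add: sum.If_cases)
  also have "\<dots> \<le> real k * real k"
    using card_mono[OF assms(1), of "T \<inter> e"] assms(2) by (intro mult_mono) auto
  finally show ?thesis by (simp add: power2_eq_square)
qed

lemma both_in_row_le:
  assumes "finite e" "card e \<le> k" "finite T" and f: "\<And>j. j \<in> T \<Longrightarrow> \<bar>f j\<bar> \<le> (1::real)"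
  shows "\<bar>\<Sum>j\<in>T. both_in e i j * f j\<bar> \<le> real (k - 1)"
proof (cases "i \<in> e")
  case True
  have "\<bar>\<Sum>j\<in>T. both_in e i j * f j\<bar> \<le> (\<Sum>j\<in>T. \<bar>both_in e i j * f j\<bar>)"
    by (rule sum_abs)
  also have "\<dots> \<le> (\<Sum>j\<in>T. if j \<in> e - {i} then 1 else 0)"
    using f by (intro sum_mono) (auto simp: both_in_def abs_mult)
  also have "\<dots> = real (card (T \<inter> (e - {i})))"
    using assms(3) by (simp add: sum.If_cases Int_def)
  also have "\<dots> \<le> real (card (e - {i}))"
    using assms(1) by (intro of_nat_mono card_mono) auto
  also have "\<dots> \<le> real (k - 1)" using assms(1,2) True by simp
  finally show ?thesis .
qed (simp add: both_in_def)

lemma balanced_labels_class_card: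
  assumes "\<sigma> \<in> balanced_labels n" "i < n"
  shows "2 * card {j \<in> {..<n}. \<sigma> j = \<sigma> i} = n"
proof -
  have val: "\<sigma> j = 1 \<or> \<sigma> j = -1" if "j < n" for j
    using assms(1) that by (auto simp: balanced_labels_def PiE_iff)
  have "{..<n} = {j \<in> {..<n}. \<sigma> j = 1} \<union> {j \<in> {..<n}. \<sigma> j = -1}" using val by auto
  moreover have "{j \<in> {..<n}. \<sigma> j = 1} \<inter> {j \<in> {..<n}. \<sigma> j = -1} = {}" by auto
  ultimately have n: "n = card {j \<in> {..<n}. \<sigma> j = 1} + card {j \<in> {..<n}. \<sigma> j = -1}"
    by (metis (no_types, lifting) card_Un_disjoint card_lessThan finite_Un finite_lessThan)
  have eq: "card {j \<in> {..<n}. \<sigma> j = 1} = card {j \<in> {..<n}. \<sigma> j = -1}"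
    using assms(1) by (simp add: balanced_labels_def)
  from val[OF assms(2)] show ?thesis
  proof
    assume "\<sigma> i = 1"
    show ?thesis unfolding \<open>\<sigma> i = 1\<close> using n eq by linarith
  next
    assume "\<sigma> i = -1"
    show ?thesis unfolding \<open>\<sigma> i = -1\<close> using n eq by linarith
  qed
qed

section \<open>The random weights conditioned on the labels\<close>

locale hsbm_given_labels =
  fixes n k :: nat and \<alpha> \<beta> :: real and \<sigma> :: "nat \<Rightarrow> real"
  assumes k: "k \<ge> 2" and n: "n \<ge> k" and \<beta>: "0 < \<beta>" and \<alpha>: "\<beta> < \<alpha>"
    and labels: "\<sigma> \<in> balanced_labels n" and p_le_1: "edge_prob n k \<alpha> \<le> 1"
begin

definition "E = nsets {..<n} k"
definition "L = ln (real n)"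
text \<open>\<open>N1\<close>, \<open>N2\<close> and \<open>Nmono\<close> count the potential
  hyperedges through a vertex, through a pair, and the monochromatic ones through a vertex. The
  limit \<open>1 / 2 ^ (k - 1)\<close> of \<open>Nmono / N1\<close> along even \<open>n\<close> is
  the source of the powers of two in \<open>I_sdp\<close>.\<close>

definition "N1 = (n - 1) choose (k - 1)"
definition "N2 = (n - 2) choose (k - 2)"
definition "Nmono = (n div 2 - 1) choose (k - 1)"
definition "p = edge_prob n k \<alpha>"
definition "q = edge_prob n k \<beta>"
definition "pe e = (if monochromatic \<sigma> e then p else q)"
definition "\<mu> = Pi_pmf E False (\<lambda>e. bernoulli_pmf (pe e))"
definition "W X = offdiag_weight {e \<in> E. X e}"
definition "M i j = (\<Sum>e\<in>E. pe e * both_in e i j)"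

lemma n2: "n \<ge> 2" using k n by simp

lemma finite_E: "finite E" by (simp add: E_def finite_imp_finite_nsets)

lemma E_D: "e \<in> E \<Longrightarrow> finite e \<and> card e = k \<and> e \<subseteq> {..<n}" by (auto simp: E_def nsets_def)

lemma L_pos: "L > 0" using n2 by (simp add: L_def)

lemma N1_pos: "N1 > 0" using n by (simp add: N1_def)

lemma p_N1: "p * N1 = \<alpha> * L" and q_N1: "q * N1 = \<beta> * L"
  using N1_pos by (simp_all add: p_def q_def edge_prob_def N1_def L_def)

lemma q_nonneg: "0 \<le> q" and q_le_p: "q \<le> p"
  using \<beta> \<alpha> L_pos unfolding p_def q_def edge_prob_def L_def[symmetric]
  by (auto intro!: divide_right_mono mult_right_mono)

lemma p_le: "p \<le> 1" using p_le_1 by (simp add: p_def)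

lemma pe_nonneg: "0 \<le> pe e" and pe_le_p: "pe e \<le> p" and pe_01: "pe e \<in> {0..1}"
  using q_nonneg q_le_p p_le by (auto simp: pe_def)

text \<open>Both sides count the hyperedges through a fixed vertex together with a further vertex
  chosen in them.\<close>

lemma N2_N1: "real (n - 1) * N2 = real (k - 1) * N1"
proof -
  have "(k - 1) * N1 = (n - 1) * N2"
    using times_binomial_minus1_eq[of "k - 1" "n - 1"] k
    by (simp add: N1_def N2_def numeral_2_eq_2)
  then show ?thesis by (metis of_nat_mult)
qed

lemma p_N2_le: "p * N2 \<le> 2 * \<alpha> * k * L / n"
proof -
  have "real (n - 1) * (p * N2) = real (k - 1) * (\<alpha> * L)"
    using N2_N1 p_N1 by (metis mult.left_commute)
  also have "\<dots> \<le> real k * (\<alpha> * L)" using \<alpha> \<beta> L_pos by (intro mult_right_mono) auto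
  finally have "real (n - 1) * (p * N2) \<le> real k * (\<alpha> * L)" .
  moreover have "real n / 2 * (p * N2) \<le> real (n - 1) * (p * N2)"
    using n2 q_nonneg q_le_p by (intro mult_right_mono) (auto simp: of_nat_diff)
  ultimately have "real n / 2 * (p * N2) \<le> real k * (\<alpha> * L)" by linarith
  then show ?thesis using n2 by (simp add: field_simps)
qed

lemma sum_both_in:
  assumes "i < n" "j < n"
  shows "(\<Sum>e\<in>E. both_in e i j) = (if i = j then 0 else real N2)"
proof (cases "i = j")
  case False
  have "(\<Sum>e\<in>E. both_in e i j) = (\<Sum>e\<in>E. if {i, j} \<subseteq> e then 1 else 0)"
    using False by (intro sum.cong) (auto simp: both_in_def)
  also have "\<dots> = real (card {e \<in> nsets {..<n} k. {i, j} \<subseteq> e})"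
    using finite_E by (simp add: E_def sum.If_cases Int_def)
  also have "\<dots> = N2"
    using assms False k by (subst card_nsets_superset) (auto simp: N2_def numeral_2_eq_2)
  finally show ?thesis using False by simp
qed (simp add: both_in_def)

lemma card_containing: "i < n \<Longrightarrow> card {e \<in> E. i \<in> e} = N1"
  using card_nsets_superset[of "{..<n}" "{i}" k] k by (simp add: E_def N1_def)

lemma sum_pe_le: "(\<Sum>e\<in>E. pe e) \<le> \<alpha> * n * L"
proof -
  have "(\<Sum>e\<in>E. pe e) \<le> (\<Sum>e\<in>E. p)" by (intro sum_mono pe_le_p)
  also have "\<dots> = p * card E" by simp
  also have "card E = n choose k" by (simp add: E_def)
  also have "p * (n choose k) \<le> p * (real k * (n choose k))"
    using k q_nonneg q_le_p mult_right_mono[of 1 "real k" "real (n choose k)"]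
    by (intro mult_left_mono) auto
  also have "real k * (n choose k) = real n * N1"
    using times_binomial_minus1_eq[of k n] k unfolding N1_def by (metis of_nat_mult gr0I not_numeral_le_zero)
  also have "p * (real n * N1) = \<alpha> * n * L" using p_N1 by (simp add: mult_ac)
  finally show ?thesis .
qed

lemma W_form: "(\<Sum>i\<in>S. \<Sum>j\<in>T. W X i j * f i j)
    = (\<Sum>e\<in>E. if X e then (\<Sum>i\<in>S. \<Sum>j\<in>T. both_in e i j * f i j) else 0)"
  unfolding W_def by (rule offdiag_weight_form[OF finite_E])

lemma W_row: "(\<Sum>j\<in>T. W X i j * f j) = (\<Sum>e\<in>E. if X e then (\<Sum>j\<in>T. both_in e i j * f j) else 0)"
  using W_form[of X "\<lambda>i j. f j" T "{i}"] by (simp cong: if_cong)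

lemma M_form: "(\<Sum>i\<in>S. \<Sum>j\<in>T. M i j * f i j) = (\<Sum>e\<in>E. pe e * (\<Sum>i\<in>S. \<Sum>j\<in>T. both_in e i j * f i j))"
proof -
  have "(\<Sum>i\<in>S. \<Sum>j\<in>T. M i j * f i j) = (\<Sum>i\<in>S. \<Sum>j\<in>T. \<Sum>e\<in>E. pe e * (both_in e i j * f i j))"
    by (simp add: M_def sum_distrib_right mult.assoc)
  also have "\<dots> = (\<Sum>i\<in>S. \<Sum>e\<in>E. \<Sum>j\<in>T. pe e * (both_in e i j * f i j))"
    by (intro sum.cong refl sum.swap)
  also have "\<dots> = (\<Sum>e\<in>E. \<Sum>i\<in>S. \<Sum>j\<in>T. pe e * (both_in e i j * f i j))"
    by (rule sum.swap)
  finally show ?thesis by (simp add: sum_distrib_left)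
qed

lemma edge_sum_tail:
  "measure_pmf.prob \<mu> {X. t \<le> (\<Sum>e\<in>E. if X e then c e else 0)} \<le> exp ((\<Sum>e\<in>E. pe e * (exp (c e) - 1)) - t)"
  unfolding \<mu>_def by (rule bernoulli_sum_tail[OF finite_E pe_01])

lemma card_monochromatic_superset:
  assumes i: "i < n" "i \<in> B" and B: "B \<subseteq> {l \<in> {..<n}. \<sigma> l = \<sigma> i}" "card B \<le> k"
  shows "card {e \<in> E. monochromatic \<sigma> e \<and> B \<subseteq> e} = (n div 2 - card B) choose (k - card B)"
proof -
  have "{e \<in> E. monochromatic \<sigma> e \<and> B \<subseteq> e} = {e \<in> nsets {l \<in> {..<n}. \<sigma> l = \<sigma> i} k. B \<subseteq> e}"
  proof (intro equalityI subsetI)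
    fix e assume "e \<in> {e \<in> E. monochromatic \<sigma> e \<and> B \<subseteq> e}"
    then have e: "e \<subseteq> {..<n}" "finite e" "card e = k" "B \<subseteq> e" and "monochromatic \<sigma> e"
      by (auto simp: E_def nsets_def)
    then have "\<sigma> a = \<sigma> i" if "a \<in> e" for a
      using that i(2) unfolding monochromatic_def by blast
    then have "e \<subseteq> {l \<in> {..<n}. \<sigma> l = \<sigma> i}" using e(1) by blast
    with e show "e \<in> {e \<in> nsets {l \<in> {..<n}. \<sigma> l = \<sigma> i} k. B \<subseteq> e}"
      by (simp add: nsets_def)
  next
    fix e assume "e \<in> {e \<in> nsets {l \<in> {..<n}. \<sigma> l = \<sigma> i} k. B \<subseteq> e}"
    then have e: "e \<subseteq> {l \<in> {..<n}. \<sigma> l = \<sigma> i}" "finite e" "card e = k" "B \<subseteq> e"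
      by (auto simp: nsets_def)
    then have "\<sigma> a = \<sigma> i" if "a \<in> e" for a using that by blast
    then have "monochromatic \<sigma> e" by (simp add: monochromatic_def)
    with e show "e \<in> {e \<in> E. monochromatic \<sigma> e \<and> B \<subseteq> e}"
      by (auto simp: E_def nsets_def)
  qed
  moreover have "card {l \<in> {..<n}. \<sigma> l = \<sigma> i} = n div 2"
    using balanced_labels_class_card[OF labels i(1)] by linarith
  ultimately show ?thesis
    using card_nsets_superset[of "{l \<in> {..<n}. \<sigma> l = \<sigma> i}" B k] B by simp
qed

text \<open>Off the diagonal the mean takes two values, so it agrees there with a rank-two matrix
  acting on the directions \<open>1\<close> and \<open>\<sigma>\<close>. Restoring the zero diagonal
  subtracts a nonnegative multiple of the squared norm.\<close>

lemma M_form_le: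
  "(\<Sum>i<n. \<Sum>j<n. M i j * y i * y j) \<le> 2 * \<alpha> * k * L / n * ((\<Sum>i<n. y i)\<^sup>2 + (\<Sum>i<n. \<sigma> i * y i)\<^sup>2)"
proof -
  define m where "m = n div 2"
  define R where "R = (m - 2) choose (k - 2)"
  have mono_count: "(\<Sum>e\<in>E. if monochromatic \<sigma> e then both_in e i j else 0) = (if \<sigma> i = \<sigma> j then real R else 0)"
    if ij: "i < n" "j < n" "i \<noteq> j" for i j
  proof -
    have "(\<Sum>e\<in>E. if monochromatic \<sigma> e then both_in e i j else 0)
        = (\<Sum>e\<in>E. if monochromatic \<sigma> e \<and> {i, j} \<subseteq> e then 1 else 0)"
      using ij by (intro sum.cong) (auto simp: both_in_def)
    also have "\<dots> = real (card {e \<in> E. monochromatic \<sigma> e \<and> {i, j} \<subseteq> e})"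
      using finite_E by (simp add: sum.If_cases Int_def)
    also have "\<dots> = (if \<sigma> i = \<sigma> j then real R else 0)"
    proof (cases "\<sigma> i = \<sigma> j")
      case True
      then show ?thesis
        using card_monochromatic_superset[of i "{i, j}"] ij k by (simp add: R_def m_def numeral_2_eq_2)
    next
      case False
      then have "{e \<in> E. monochromatic \<sigma> e \<and> {i, j} \<subseteq> e} = {}" by (auto simp: monochromatic_def)
      then show ?thesis using False by (metis card.empty of_nat_0)
    qed
    finally show ?thesis .
  qed
  \<comment> \<open>Entries within a class are \<open>q * N2 + (p - q) * R\<close>, entries across
    classes \<open>q * N2\<close>; \<open>a\<close> and \<open>b\<close> are their half sum and half
    difference.\<close>
  define a b where "a = q * N2 + (p - q) * R / 2" and "b = (p - q) * R / 2"
  have M_eq: "M i j = a + b * (\<sigma> i * \<sigma> j)" if ij: "i < n" "j < n" "i \<noteq> j" for i j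
  proof -
    have "M i j = (\<Sum>e\<in>E. q * both_in e i j + (p - q) * (if monochromatic \<sigma> e then both_in e i j else 0))"
      unfolding M_def pe_def by (intro sum.cong refl) (simp add: algebra_simps)
    also have "\<dots> = q * N2 + (p - q) * (if \<sigma> i = \<sigma> j then R else 0)"
      using sum_both_in[of i j] mono_count[OF ij] ij by (simp add: sum.distrib flip: sum_distrib_left)
    also have "\<dots> = a + b * (\<sigma> i * \<sigma> j)"
    proof (cases "\<sigma> i = \<sigma> j")
      case True
      then show ?thesis using balanced_labels_sq[OF labels ij(1)] by (simp add: a_def b_def)
    next
      case False
      have "\<sigma> i \<in> {1, -1}" "\<sigma> j \<in> {1, -1}" using labels ij by (auto simp: balanced_labels_def PiE_iff)
      then have "\<sigma> i * \<sigma> j = -1" using False by auto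
      then show ?thesis using False by (simp add: a_def b_def)
    qed
    finally show ?thesis .
  qed
  have "R \<le> N2" unfolding R_def N2_def m_def by (intro binomial_right_mono) auto
  then have R_le: "(p - q) * R / 2 \<le> (p - q) * N2 / 2" "0 \<le> (p - q) * R / 2" "0 \<le> (p - q) * N2"
    using q_le_p by (auto intro!: mult_left_mono divide_right_mono)
  have "0 \<le> q * N2" using q_nonneg by simp
  then have a: "0 \<le> a" "a \<le> p * N2" and b: "0 \<le> b" "b \<le> p * N2"
    unfolding a_def b_def using R_le left_diff_distrib[of p q "real N2"] by linarith+
  have "(\<Sum>i<n. \<Sum>j<n. M i j * y i * y j)
      = (\<Sum>i<n. \<Sum>j<n. a * (y i * y j) + b * ((\<sigma> i * y i) * (\<sigma> j * y j)) - (if i = j then (a + b) * (y i)\<^sup>2 else 0))"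
  proof (intro sum.cong refl)
    fix i j assume ij: "i \<in> {..<n}" "j \<in> {..<n}"
    show "M i j * y i * y j = a * (y i * y j) + b * ((\<sigma> i * y i) * (\<sigma> j * y j)) - (if i = j then (a + b) * (y i)\<^sup>2 else 0)"
    proof (cases "i = j")
      case True
      have "(\<sigma> i * y i) * (\<sigma> i * y i) = (\<sigma> i * \<sigma> i) * (y i * y i)" by (simp add: mult_ac)
      then have "(\<sigma> i * y i) * (\<sigma> i * y i) = y i * y i" using balanced_labels_sq[OF labels] ij by simp
      then show ?thesis using True by (simp add: M_def both_in_def power2_eq_square algebra_simps)
    next
      case False
      then show ?thesis using ij M_eq[of i j] by (simp add: algebra_simps)
    qed
  qed
  also have "\<dots> = a * (\<Sum>i<n. y i)\<^sup>2 + b * (\<Sum>i<n. \<sigma> i * y i)\<^sup>2 - (\<Sum>i<n. (a + b) * (y i)\<^sup>2)"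
  proof -
    have "u * (\<Sum>i<n. f i)\<^sup>2 = (\<Sum>i<n. \<Sum>j<n. u * (f i * f j))" for u and f :: "nat \<Rightarrow> real"
      unfolding power2_eq_square sum_product by (simp only: sum_distrib_left)
    then show ?thesis by (simp add: sum.distrib sum_subtractf)
  qed
  also have "\<dots> \<le> a * (\<Sum>i<n. y i)\<^sup>2 + b * (\<Sum>i<n. \<sigma> i * y i)\<^sup>2"
    using a b by (auto intro!: sum_nonneg)
  also have "\<dots> \<le> 2 * \<alpha> * k * L / n * (\<Sum>i<n. y i)\<^sup>2 + 2 * \<alpha> * k * L / n * (\<Sum>i<n. \<sigma> i * y i)\<^sup>2"
    using a b p_N2_le by (intro add_mono mult_right_mono) auto
  finally show ?thesis by (simp add: distrib_left)
qed

section \<open>Tail bounds for the four kinds of bad events\<close>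

text \<open>Chernoff parameter 1 suffices: a hyperedge adds at most \<open>k - 1\<close>, so the
  moment term is at most \<open>\<alpha> * exp k * L\<close>, and the extra \<open>2 * L\<close>
  leaves a margin over the \<open>n\<close> vertices.\<close>

lemma degree_tail:
  assumes "i < n"
  shows "measure_pmf.prob \<mu> {X. (\<alpha> * exp k + 2) * L \<le> (\<Sum>j<n. W X i j)} \<le> exp (- 2 * L)"
proof -
  define c where "c = (\<lambda>e. \<Sum>j<n. both_in e i j)"
  have "measure_pmf.prob \<mu> {X. (\<alpha> * exp k + 2) * L \<le> (\<Sum>j<n. W X i j)}
      \<le> exp ((\<Sum>e\<in>E. pe e * (exp (c e) - 1)) - (\<alpha> * exp k + 2) * L)"
  proof -
    have "(\<Sum>j<n. W X i j) = (\<Sum>e\<in>E. if X e then c e else 0)" for X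
      using W_row[of X i "\<lambda>_. 1" "{..<n}"] unfolding c_def mult_1_right .
    then show ?thesis using edge_sum_tail by simp
  qed
  also have "(\<Sum>e\<in>E. pe e * (exp (c e) - 1)) \<le> (\<Sum>e\<in>E. if i \<in> e then p * exp k else 0)"
  proof (intro sum_mono)
    fix e assume e: "e \<in> E"
    show "pe e * (exp (c e) - 1) \<le> (if i \<in> e then p * exp k else 0)"
    proof (cases "i \<in> e")
      case True
      have "\<bar>c e\<bar> \<le> real (k - 1)"
        using both_in_row_le[of e k "{..<n}" "\<lambda>_. 1" i] E_D[OF e] by (simp add: c_def)
      then have "exp (c e) - 1 \<le> exp (real k)" by (smt (verit) exp_le_cancel_iff exp_gt_zero of_nat_mono diff_le_self)
      moreover have "0 \<le> c e" unfolding c_def by (intro sum_nonneg) (simp add: both_in_def)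
      ultimately show ?thesis
        using True pe_nonneg pe_le_p q_nonneg q_le_p by (auto intro!: mult_mono)
    next
      case False
      then show ?thesis by (simp add: c_def both_in_def)
    qed
  qed
  also have "\<dots> = p * exp k * N1"
    using finite_E card_containing[OF assms] by (simp add: sum.If_cases Int_def)
  also have "p * exp k * N1 = \<alpha> * exp k * L" using p_N1 by (simp add: mult_ac)
  finally show ?thesis by (simp add: algebra_simps)
qed

text \<open>The expected weight inside \<open>T\<close> is a fraction of order
  \<open>\<gamma>\<close> of \<open>L * card T\<close>, so a large Chernoff parameter is affordable.
  Hypothesis \<open>small\<close> keeps the moment term below \<open>L * card T\<close>; against the
  threshold term \<open>4 * L * card T\<close> this leaves a factor \<open>1 / n ^ 3\<close> per
  vertex, enough to beat the number of sets.\<close>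

lemma sparse_tail:
  fixes \<gamma> \<eta> :: real
  assumes T: "T \<subseteq> {..<n}" "real (card T) \<le> 2 * \<gamma> * n" and "\<eta> > 0"
    and small: "16 * \<alpha> * k * \<gamma> / \<eta> * exp (4 * real k ^ 2 / \<eta>) \<le> 1"
  shows "measure_pmf.prob \<mu> {X. \<eta> * L * card T \<le> (\<Sum>i\<in>T. \<Sum>j\<in>T. W X i j)} \<le> exp (- 3 * L * card T)"
proof -
  define \<theta> where "\<theta> = 4 / \<eta>"
  have \<theta>: "\<theta> > 0" "\<theta> * \<eta> = 4" using assms by (simp_all add: \<theta>_def)
  define c where "c = (\<lambda>e. \<Sum>i\<in>T. \<Sum>j\<in>T. both_in e i j)"
  have finT: "finite T" using T finite_subset by blast
  have c_nonneg: "0 \<le> c e" for e unfolding c_def by (intro sum_nonneg) (simp add: both_in_def)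
  have "{X. \<eta> * L * card T \<le> (\<Sum>i\<in>T. \<Sum>j\<in>T. W X i j)}
      = {X. \<theta> * (\<eta> * L * card T) \<le> (\<Sum>e\<in>E. if X e then \<theta> * c e else 0)}"
  proof -
    have "(\<Sum>e\<in>E. if X e then \<theta> * c e else 0) = \<theta> * (\<Sum>i\<in>T. \<Sum>j\<in>T. W X i j)" for X
      using W_form[of X "\<lambda>_ _. 1" T T] unfolding c_def by (simp add: sum_distrib_left if_distrib cong: if_cong)
    moreover have "\<theta> * x \<le> \<theta> * y \<longleftrightarrow> x \<le> y" for x y using \<theta>(1) by simp
    ultimately show ?thesis by (simp only:)
  qed
  also have "measure_pmf.prob \<mu> \<dots> \<le> exp ((\<Sum>e\<in>E. pe e * (exp (\<theta> * c e) - 1)) - \<theta> * (\<eta> * L * card T))"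
    by (rule edge_sum_tail)
  \<comment> \<open>Bounding \<open>exp x - 1\<close> by \<open>x * exp x\<close> preserves the
    factor \<open>c e\<close>, whose sum over the hyperedges is at most quadratic in
    \<open>card T\<close>; one of the two factors \<open>card T\<close> is then traded for
    \<open>2 * \<gamma> * n\<close>.\<close>
  also have "(\<Sum>e\<in>E. pe e * (exp (\<theta> * c e) - 1)) \<le> (\<Sum>e\<in>E. p * (\<theta> * c e * exp (\<theta> * k ^ 2)))"
  proof (intro sum_mono mult_mono)
    fix e assume e: "e \<in> E"
    have "c e \<le> real k ^ 2"
      using both_in_form_le[of e k T "\<lambda>_ _. 1"] E_D[OF e] finT by (simp add: c_def)
    then have "exp (\<theta> * c e) \<le> exp (\<theta> * k ^ 2)" using \<theta> by simp
    moreover have "exp (\<theta> * c e) - 1 \<le> \<theta> * c e * exp (\<theta> * c e)"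
    proof -
      have "(1 - \<theta> * c e) * exp (\<theta> * c e) \<le> exp (- (\<theta> * c e)) * exp (\<theta> * c e)"
        using exp_ge_add_one_self[of "- (\<theta> * c e)"] by (intro mult_right_mono) auto
      then show ?thesis by (simp add: algebra_simps flip: exp_add)
    qed
    moreover have "\<theta> * c e * exp (\<theta> * c e) \<le> \<theta> * c e * exp (\<theta> * k ^ 2)"
      using calculation(1) \<theta> c_nonneg by (intro mult_left_mono) auto
    ultimately show "exp (\<theta> * c e) - 1 \<le> \<theta> * c e * exp (\<theta> * k ^ 2)" by linarith
  qed (use pe_le_p q_nonneg q_le_p \<theta> c_nonneg in auto)
  also have "\<dots> = p * \<theta> * exp (\<theta> * k ^ 2) * (\<Sum>e\<in>E. c e)"
    unfolding sum_distrib_left by (intro sum.cong refl) (simp add: mult_ac)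
  also have "(\<Sum>e\<in>E. c e) = (\<Sum>i\<in>T. \<Sum>j\<in>T. \<Sum>e\<in>E. both_in e i j)"
    unfolding c_def by (subst sum.swap) (intro sum.cong refl sum.swap)
  also have "\<dots> \<le> (\<Sum>i\<in>T. \<Sum>j\<in>T. real N2)"
  proof (intro sum_mono)
    fix i j assume "i \<in> T" "j \<in> T"
    then have "i < n" "j < n" using T by auto
    then show "(\<Sum>e\<in>E. both_in e i j) \<le> real N2" by (simp add: sum_both_in)
  qed
  also have "(\<Sum>i\<in>T. \<Sum>j\<in>T. real N2) = real (card T) * real (card T) * N2" by simp
  also have "p * \<theta> * exp (\<theta> * k ^ 2) * (real (card T) * real (card T) * N2)
      = (p * N2) * real (card T) * (\<theta> * exp (\<theta> * k ^ 2) * card T)" by (simp add: mult_ac)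
  also have "\<dots> \<le> (2 * \<alpha> * k * L / n) * (2 * \<gamma> * n) * (\<theta> * exp (\<theta> * k ^ 2) * card T)"
    using p_N2_le T(2) \<theta> q_nonneg q_le_p \<alpha> \<beta> L_pos by (intro mult_right_mono mult_mono) auto
  also have "\<dots> = (16 * \<alpha> * k * \<gamma> / \<eta> * exp (4 * real k ^ 2 / \<eta>)) * (L * card T)"
    using n2 by (simp add: \<theta>_def)
  also have "\<dots> \<le> 1 * (L * card T)"
    using small L_pos by (intro mult_right_mono) auto
  also have "\<theta> * (\<eta> * L * card T) = 4 * (L * card T)" by (simp only: mult.assoc[symmetric] \<theta>)
  finally show ?thesis
    using \<theta> q_nonneg q_le_p by (simp add: mult_left_mono mult.assoc)
qed

text \<open>Centering by \<open>M\<close> cancels the linear term of the exponential moment; the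
  quadratic one is controlled by the expected number of hyperedges. What remains scales with
  \<open>n * L\<close>, and for any \<open>K > 0\<close> a small \<open>\<theta>\<close> makes it
  negative.\<close>

lemma sign_tail:
  fixes s :: "nat \<Rightarrow> real" and K \<theta> :: real
  assumes s: "\<forall>i\<in>{..<n}. s i \<in> {1, -1}" and \<theta>: "0 < \<theta>" "\<theta> * k ^ 2 \<le> 1"
  shows "measure_pmf.prob \<mu> {X. K * L * n \<le> (\<Sum>i<n. \<Sum>j<n. (W X i j - M i j) * s i * s j)}
    \<le> exp (n * L * (\<alpha> * \<theta>\<^sup>2 * k ^ 4 - \<theta> * K))"
proof -
  define c where "c = (\<lambda>e. \<Sum>i<n. \<Sum>j<n. both_in e i j * (s i * s j))"
  have "(\<Sum>i<n. \<Sum>j<n. (W X i j - M i j) * s i * s j) = (\<Sum>e\<in>E. if X e then c e else 0) - (\<Sum>e\<in>E. pe e * c e)" for X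
  proof -
    have "(\<Sum>i<n. \<Sum>j<n. (W X i j - M i j) * s i * s j)
        = (\<Sum>i<n. \<Sum>j<n. W X i j * (s i * s j)) - (\<Sum>i<n. \<Sum>j<n. M i j * (s i * s j))"
      by (simp add: algebra_simps sum_subtractf)
    then show ?thesis unfolding W_form M_form c_def .
  qed
  moreover have "(\<Sum>e\<in>E. if X e then \<theta> * c e else 0) = \<theta> * (\<Sum>e\<in>E. if X e then c e else 0)" for X
    by (simp add: sum_distrib_left if_distrib cong: if_cong)
  moreover have "\<theta> * x \<le> \<theta> * y \<longleftrightarrow> x \<le> y" for x y using \<theta>(1) by simp
  ultimately have set_eq: "{X. K * L * n \<le> (\<Sum>i<n. \<Sum>j<n. (W X i j - M i j) * s i * s j)}
      = {X. \<theta> * (K * L * n + (\<Sum>e\<in>E. pe e * c e)) \<le> (\<Sum>e\<in>E. if X e then \<theta> * c e else 0)}"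
    by (simp only: le_diff_eq)
  have prob: "measure_pmf.prob \<mu> {X. K * L * n \<le> (\<Sum>i<n. \<Sum>j<n. (W X i j - M i j) * s i * s j)}
      \<le> exp ((\<Sum>e\<in>E. pe e * (exp (\<theta> * c e) - 1)) - \<theta> * (K * L * n + (\<Sum>e\<in>E. pe e * c e)))"
    unfolding set_eq by (rule edge_sum_tail)
  have "(\<Sum>e\<in>E. pe e * (exp (\<theta> * c e) - 1)) \<le> (\<Sum>e\<in>E. pe e * (\<theta> * c e + \<theta>\<^sup>2 * k ^ 4))"
  proof (rule sum_mono, rule mult_left_mono[OF _ pe_nonneg])
    fix e assume e: "e \<in> E"
    have s_abs: "\<bar>s i\<bar> = 1" if "i < n" for i using bspec[OF s, of i] that by auto
    have c: "\<bar>c e\<bar> \<le> real k ^ 2"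
      unfolding c_def using E_D[OF e] s_abs by (intro both_in_form_le) (auto simp: abs_mult)
    have "\<bar>\<theta> * c e\<bar> \<le> \<theta> * k ^ 2" using c \<theta> by (simp add: abs_mult)
    then have "exp (\<theta> * c e) \<le> 1 + \<theta> * c e + (\<theta> * c e)\<^sup>2"
      using \<theta> by (intro exp_le_quadratic) auto
    moreover have "(\<theta> * c e)\<^sup>2 \<le> (\<theta> * k ^ 2)\<^sup>2"
      using \<open>\<bar>\<theta> * c e\<bar> \<le> \<theta> * k ^ 2\<close> by (simp add: abs_le_square_iff[symmetric])
    ultimately show "exp (\<theta> * c e) - 1 \<le> \<theta> * c e + \<theta>\<^sup>2 * k ^ 4"
      by (simp add: power_mult_distrib flip: power_mult)
  qed
  also have "\<dots> = \<theta> * (\<Sum>e\<in>E. pe e * c e) + \<theta>\<^sup>2 * k ^ 4 * (\<Sum>e\<in>E. pe e)"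
    unfolding sum_distrib_left sum.distrib[symmetric] by (intro sum.cong refl) (simp add: algebra_simps)
  also have "\<theta>\<^sup>2 * k ^ 4 * (\<Sum>e\<in>E. pe e) \<le> \<theta>\<^sup>2 * k ^ 4 * (\<alpha> * n * L)"
    by (intro mult_left_mono sum_pe_le) auto
  finally have "(\<Sum>e\<in>E. pe e * (exp (\<theta> * c e) - 1)) - \<theta> * (K * L * n + (\<Sum>e\<in>E. pe e * c e))
      \<le> n * L * (\<alpha> * \<theta>\<^sup>2 * k ^ 4 - \<theta> * K)"
    by (simp add: algebra_simps)
  then show ?thesis using prob by (meson exp_le_cancel_iff order_trans)
qed

text \<open>The labels sum to zero, so the products \<open>\<sigma> i * \<sigma> j\<close> over
  \<open>j \<noteq> i\<close> add up to -1. This drift has relative order \<open>1 / n\<close> and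
  disappears from the limiting exponent.\<close>

lemma sum_signed_row:
  assumes i: "i < n"
  shows "(\<Sum>e\<in>E. \<Sum>j<n. both_in e i j * (\<sigma> i * \<sigma> j)) = - real N2"
proof -
  have "(\<Sum>e\<in>E. \<Sum>j<n. both_in e i j * (\<sigma> i * \<sigma> j)) = (\<Sum>j<n. \<Sum>e\<in>E. both_in e i j * (\<sigma> i * \<sigma> j))"
    by (rule sum.swap)
  also have "\<dots> = (\<Sum>j<n. real N2 * \<sigma> i * \<sigma> j - (if j = i then real N2 * (\<sigma> i * \<sigma> i) else 0))"
    using i by (intro sum.cong refl) (auto simp: sum_both_in simp flip: sum_distrib_right)
  also have "\<dots> = - real N2"
    using i balanced_labels_sum[OF labels] balanced_labels_sq[OF labels i]
    by (simp add: sum_subtractf flip: sum_distrib_left)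
  finally show ?thesis .
qed

text \<open>The cross terms of the expanded square nearly cancel, because the labels other than
  \<open>\<sigma> i\<close> sum to \<open>- \<sigma> i\<close>. The bound equals
  \<open>(k - 1) * N1\<close>, a factor \<open>k - 1\<close> below what bounding each square by
  \<open>(k - 1)\<^sup>2\<close> would give; this saving is needed to reach
  \<open>I_sdp\<close>.\<close>

lemma sum_signed_row_sq_le:
  assumes i: "i < n"
  shows "(\<Sum>e\<in>E. (\<Sum>j<n. both_in e i j * (\<sigma> i * \<sigma> j))\<^sup>2) \<le> real (n - 1) * N2"
proof -
  \<comment> \<open>For \<open>k = 2\<close> no hyperedge contains three vertices, whereas
    \<open>(n - 3) choose 0\<close> would be 1.\<close>
  define N3 where "N3 = real (if 3 \<le> k then (n - 3) choose (k - 3) else 0)"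
  define V where "V = {..<n} - {i}"
  have finV: "finite V" by (simp add: V_def)
  have pair: "(\<Sum>e\<in>E. both_in e i j * both_in e i l) = N3 + (if j = l then N2 - N3 else 0)"
    if jl: "j \<in> V" "l \<in> V" for j l
  proof -
    have "(\<Sum>e\<in>E. both_in e i j * both_in e i l) = (\<Sum>e\<in>E. if {i, j, l} \<subseteq> e then 1 else 0)"
      using jl by (intro sum.cong) (auto simp: both_in_def V_def)
    also have "\<dots> = real (card {e \<in> nsets {..<n} k. {i, j, l} \<subseteq> e})"
      using finite_E by (simp add: E_def sum.If_cases Int_def)
    also have "card {e \<in> nsets {..<n} k. {i, j, l} \<subseteq> e} =
        (if card {i, j, l} \<le> k then (n - card {i, j, l}) choose (k - card {i, j, l}) else 0)"
      using jl i by (subst card_nsets_superset) (auto simp: V_def)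
    also have "card {i, j, l} = (if j = l then 2 else 3)" using jl by (auto simp: V_def)
    finally show ?thesis using k by (auto simp: N3_def N2_def)
  qed
  have sq_eq: "(\<Sum>j<n. both_in e i j * (\<sigma> i * \<sigma> j))\<^sup>2 = (\<Sum>j\<in>V. \<Sum>l\<in>V. both_in e i j * both_in e i l * (\<sigma> j * \<sigma> l))" for e
  proof -
    have "(\<Sum>j<n. both_in e i j * (\<sigma> i * \<sigma> j)) = \<sigma> i * (\<Sum>j\<in>V. both_in e i j * \<sigma> j)"
      using i by (simp add: sum.remove[of "{..<n}" i] V_def both_in_def sum_distrib_left mult_ac)
    then have "(\<Sum>j<n. both_in e i j * (\<sigma> i * \<sigma> j))\<^sup>2 = (\<sigma> i * \<sigma> i) * (\<Sum>j\<in>V. both_in e i j * \<sigma> j)\<^sup>2"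
      by (simp add: power2_eq_square mult_ac)
    also have "\<dots> = (\<Sum>j\<in>V. \<Sum>l\<in>V. both_in e i j * \<sigma> j * (both_in e i l * \<sigma> l))"
      unfolding balanced_labels_sq[OF labels i] mult_1 power2_eq_square by (rule sum_product)
    finally show ?thesis by (simp add: mult_ac)
  qed
  have "(\<Sum>e\<in>E. (\<Sum>j<n. both_in e i j * (\<sigma> i * \<sigma> j))\<^sup>2)
      = (\<Sum>e\<in>E. \<Sum>j\<in>V. \<Sum>l\<in>V. both_in e i j * both_in e i l * (\<sigma> j * \<sigma> l))"
    by (simp only: sq_eq)
  also have "\<dots> = (\<Sum>j\<in>V. \<Sum>l\<in>V. \<Sum>e\<in>E. both_in e i j * both_in e i l * (\<sigma> j * \<sigma> l))"
    by (subst sum.swap) (intro sum.cong refl sum.swap)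
  also have "\<dots> = (\<Sum>j\<in>V. \<Sum>l\<in>V. N3 * (\<sigma> j * \<sigma> l) + (if j = l then (N2 - N3) * (\<sigma> j * \<sigma> l) else 0))"
    by (intro sum.cong refl) (simp add: pair distrib_right flip: sum_distrib_right)
  also have "\<dots> = (\<Sum>j\<in>V. \<Sum>l\<in>V. N3 * (\<sigma> j * \<sigma> l)) + (\<Sum>j\<in>V. (N2 - N3) * (\<sigma> j * \<sigma> j))"
    using finV by (simp add: sum.distrib)
  also have "(\<Sum>j\<in>V. \<Sum>l\<in>V. N3 * (\<sigma> j * \<sigma> l)) = N3 * ((\<Sum>j\<in>V. \<sigma> j) * (\<Sum>l\<in>V. \<sigma> l))"
    unfolding sum_product by (simp only: sum_distrib_left)
  also have "(\<Sum>j\<in>V. \<sigma> j) = - \<sigma> i"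
    using balanced_labels_sum[OF labels] i by (simp add: V_def sum_diff1)
  also have "(\<Sum>j\<in>V. (N2 - N3) * (\<sigma> j * \<sigma> j)) = (\<Sum>j\<in>V. N2 - N3)"
    by (intro sum.cong refl) (simp add: V_def balanced_labels_sq[OF labels])
  also have "(\<Sum>j\<in>V. N2 - N3) = real (n - 1) * (N2 - N3)" using i by (simp add: V_def)
  also have "N3 * (- \<sigma> i * - \<sigma> i) = N3" using balanced_labels_sq[OF labels i] by simp
  also have "N3 + real (n - 1) * (N2 - N3) \<le> real (n - 1) * N2"
  proof -
    have "1 * N3 \<le> real (n - 1) * N3" using n2 by (intro mult_right_mono) (auto simp: N3_def)
    then show ?thesis by (simp add: right_diff_distrib)
  qed
  finally show ?thesis .
qed

text \<open>The presence probability is split into \<open>q\<close> on all hyperedges plus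
  \<open>p - q\<close> on the monochromatic ones. The first part is bounded through two moments of
  the signed row; in the second every hyperedge through \<open>i\<close> has signed row exactly
  \<open>k - 1\<close>, which makes the negative drift explicit.\<close>

lemma signed_degree_tail:
  fixes t \<epsilon> :: real
  assumes i: "i < n" and t: "0 < t" "t * real (k - 1) \<le> 1"
  shows "measure_pmf.prob \<mu> {X. (\<Sum>j<n. W X i j * \<sigma> i * \<sigma> j) \<le> \<epsilon> * L}
    \<le> exp (L * (\<beta> * real (k - 1) * (t / real (n - 1) + t\<^sup>2)
        - (\<alpha> - \<beta>) * (Nmono / N1) * (t * real (k - 1) - (t * real (k - 1))\<^sup>2 / 2) + t * \<epsilon>))"
proof -
  define m where "m = real (k - 1)"
  define c where "c = (\<lambda>e. \<Sum>j<n. both_in e i j * (\<sigma> i * \<sigma> j))"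
  have row: "(\<Sum>j<n. W X i j * \<sigma> i * \<sigma> j) = (\<Sum>e\<in>E. if X e then c e else 0)" for X
    using W_row[of X i "\<lambda>j. \<sigma> i * \<sigma> j" "{..<n}"] unfolding c_def by (simp add: mult.assoc cong: if_cong)
  have set_eq: "{X. (\<Sum>j<n. W X i j * \<sigma> i * \<sigma> j) \<le> \<epsilon> * L} = {X. - (t * (\<epsilon> * L)) \<le> (\<Sum>e\<in>E. if X e then - (t * c e) else 0)}"
  proof -
    have "(\<Sum>e\<in>E. if X e then - (t * c e) else 0) = - (t * (\<Sum>e\<in>E. if X e then c e else 0))" for X
      unfolding sum_distrib_left sum_negf[symmetric] by (intro sum.cong refl) simp
    then show ?thesis using t(1) by (simp add: row)
  qed
  have prob: "measure_pmf.prob \<mu> {X. (\<Sum>j<n. W X i j * \<sigma> i * \<sigma> j) \<le> \<epsilon> * L}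
      \<le> exp ((\<Sum>e\<in>E. pe e * (exp (- (t * c e)) - 1)) - - (t * (\<epsilon> * L)))"
    unfolding set_eq by (rule edge_sum_tail)
  have c_abs: "\<bar>c e\<bar> \<le> m" if "e \<in> E" for e
  proof -
    have "\<bar>\<sigma> i * \<sigma> j\<bar> \<le> 1" if "j < n" for j
    proof -
      have "\<sigma> i \<in> {1, -1}" "\<sigma> j \<in> {1, -1}"
        using labels i that by (auto simp: balanced_labels_def PiE_iff)
      then show ?thesis by auto
    qed
    then show ?thesis
      unfolding c_def m_def using E_D[OF that] by (intro both_in_row_le) auto
  qed
  have all: "q * (\<Sum>e\<in>E. exp (- (t * c e)) - 1) \<le> L * (\<beta> * m * (t / real (n - 1) + t\<^sup>2))"
  proof -
    have "(\<Sum>e\<in>E. exp (- (t * c e)) - 1) \<le> (\<Sum>e\<in>E. t\<^sup>2 * (c e)\<^sup>2 - t * c e)"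
    proof (rule sum_mono)
      fix e assume "e \<in> E"
      then have "\<bar>t * c e\<bar> \<le> t * m" using c_abs t(1) by (simp add: abs_mult)
      then have "exp (- (t * c e)) \<le> 1 + - (t * c e) + (- (t * c e))\<^sup>2"
        using t(2) by (intro exp_le_quadratic) (simp add: m_def)
      then show "exp (- (t * c e)) - 1 \<le> t\<^sup>2 * (c e)\<^sup>2 - t * c e" by (simp add: power_mult_distrib)
    qed
    also have "\<dots> = t\<^sup>2 * (\<Sum>e\<in>E. (c e)\<^sup>2) - t * (\<Sum>e\<in>E. c e)"
      by (simp add: sum_subtractf sum_distrib_left)
    also have "\<dots> \<le> t\<^sup>2 * (real (n - 1) * N2) + t * N2"
      using sum_signed_row[OF i] mult_left_mono[OF sum_signed_row_sq_le[OF i], of "t\<^sup>2"] by (simp add: c_def)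
    also have "t\<^sup>2 * (real (n - 1) * N2) + t * N2 = (real (n - 1) * N2) * (t / real (n - 1) + t\<^sup>2)"
      using n2 by (simp add: field_simps)
    finally have "q * (\<Sum>e\<in>E. exp (- (t * c e)) - 1) \<le> q * ((real (n - 1) * N2) * (t / real (n - 1) + t\<^sup>2))"
      using q_nonneg by (rule mult_left_mono)
    also have "\<dots> = (q * N1) * (m * (t / real (n - 1) + t\<^sup>2))" by (simp only: N2_N1 m_def mult_ac)
    also have "\<dots> = L * (\<beta> * m * (t / real (n - 1) + t\<^sup>2))" by (simp add: q_N1)
    finally show ?thesis .
  qed
  have mono: "(p - q) * (\<Sum>e\<in>E. if monochromatic \<sigma> e then exp (- (t * c e)) - 1 else 0)
      \<le> L * (- ((\<alpha> - \<beta>) * (Nmono / N1) * (t * m - (t * m)\<^sup>2 / 2)))"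
  proof -
    have "(\<Sum>e\<in>E. if monochromatic \<sigma> e then exp (- (t * c e)) - 1 else 0)
        = (\<Sum>e\<in>E. if monochromatic \<sigma> e \<and> {i} \<subseteq> e then exp (- (t * m)) - 1 else 0)"
    proof (intro sum.cong refl)
      fix e assume e: "e \<in> E"
      have "c e = m" if "monochromatic \<sigma> e" "i \<in> e"
      proof -
        have "c e = (\<Sum>j<n. if j \<in> e - {i} then 1 else 0)"
          unfolding c_def
        proof (intro sum.cong refl)
          fix j assume "j \<in> {..<n}"
          show "both_in e i j * (\<sigma> i * \<sigma> j) = (if j \<in> e - {i} then 1 else 0)"
          proof (cases "j \<in> e")
            case True
            then have "\<sigma> j = \<sigma> i" using that unfolding monochromatic_def by blast
            then show ?thesis using True that balanced_labels_sq[OF labels i] by (auto simp: both_in_def)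
          qed (simp add: both_in_def)
        qed
        also have "\<dots> = real (card ({..<n} \<inter> (e - {i})))" by (simp add: sum.If_cases Int_def)
        also have "{..<n} \<inter> (e - {i}) = e - {i}" using E_D[OF e] by auto
        finally show ?thesis using that E_D[OF e] by (simp add: m_def)
      qed
      moreover have "c e = 0" if "i \<notin> e" using that by (simp add: c_def both_in_def)
      ultimately show "(if monochromatic \<sigma> e then exp (- (t * c e)) - 1 else 0)
          = (if monochromatic \<sigma> e \<and> {i} \<subseteq> e then exp (- (t * m)) - 1 else 0)" by auto
    qed
    also have "\<dots> = real (card {e \<in> E. monochromatic \<sigma> e \<and> {i} \<subseteq> e}) * (exp (- (t * m)) - 1)"
      using finite_E by (simp add: sum.If_cases Int_def)
    also have "card {e \<in> E. monochromatic \<sigma> e \<and> {i} \<subseteq> e} = Nmono"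
      using card_monochromatic_superset[of i "{i}"] i k by (simp add: Nmono_def)
    also have "real Nmono * (exp (- (t * m)) - 1) \<le> real Nmono * (- (t * m - (t * m)\<^sup>2 / 2))"
      using exp_minus_le_quadratic[of "t * m"] t(1) by (intro mult_left_mono) (auto simp: m_def)
    finally have "(p - q) * (\<Sum>e\<in>E. if monochromatic \<sigma> e then exp (- (t * c e)) - 1 else 0)
        \<le> (p - q) * (real Nmono * (- (t * m - (t * m)\<^sup>2 / 2)))"
      using q_le_p by (intro mult_left_mono) auto
    also have "\<dots> = ((p - q) * N1) * (Nmono / N1) * (- (t * m - (t * m)\<^sup>2 / 2))"
      using N1_pos by simp
    also have "(p - q) * N1 = (\<alpha> - \<beta>) * L" using p_N1 q_N1 by (simp add: left_diff_distrib)
    finally show ?thesis by (simp only: mult_ac)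
  qed
  have "(\<Sum>e\<in>E. pe e * (exp (- (t * c e)) - 1))
      = (\<Sum>e\<in>E. q * (exp (- (t * c e)) - 1) + (p - q) * (if monochromatic \<sigma> e then exp (- (t * c e)) - 1 else 0))"
    unfolding pe_def by (intro sum.cong refl) (simp add: algebra_simps)
  also have "\<dots> = q * (\<Sum>e\<in>E. exp (- (t * c e)) - 1)
      + (p - q) * (\<Sum>e\<in>E. if monochromatic \<sigma> e then exp (- (t * c e)) - 1 else 0)"
    by (simp only: sum.distrib sum_distrib_left)
  finally have "(\<Sum>e\<in>E. pe e * (exp (- (t * c e)) - 1)) - - (t * (\<epsilon> * L))
      \<le> L * (\<beta> * m * (t / real (n - 1) + t\<^sup>2)) + L * (- ((\<alpha> - \<beta>) * (Nmono / N1) * (t * m - (t * m)\<^sup>2 / 2))) + t * (\<epsilon> * L)"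
    using all mono by linarith
  also have "\<dots> = L * (\<beta> * m * (t / real (n - 1) + t\<^sup>2) - (\<alpha> - \<beta>) * (Nmono / N1) * (t * m - (t * m)\<^sup>2 / 2) + t * \<epsilon>)"
  proof -
    have "L * a + L * (- b) + t * (\<epsilon> * L) = L * (a - b + t * \<epsilon>)" for a b
      by (simp add: algebra_simps)
    then show ?thesis .
  qed
  finally show ?thesis using prob unfolding m_def by (meson exp_le_cancel_iff order_trans)
qed

section \<open>Recovery and its failure probability for fixed labels\<close>

text \<open>The deterministic part. \<open>budget\<close> collects the errors of the form bound in
  units of \<open>L\<close>: fluctuation on sign vectors, the mean with
  \<open>c = 2 * \<alpha> * k * L / n\<close>, degrees, and sparse sets.\<close>

lemma sdp_recovers_labels:
  fixes \<epsilon> \<Delta> \<gamma> \<eta> \<kappa> K :: real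
  assumes pos: "0 < \<gamma>" "0 < \<eta>" "0 < \<kappa>"
    and budget: "K / \<gamma> + 8 * \<alpha> * k * \<gamma> + 2 * \<Delta> / \<kappa> + 3 * \<kappa> * \<eta> < \<epsilon>"
    and signed: "\<And>i. i < n \<Longrightarrow> (\<Sum>j<n. W X i j * \<sigma> i * \<sigma> j) > \<epsilon> * L"
    and deg: "\<And>i. i < n \<Longrightarrow> (\<Sum>j<n. W X i j) < \<Delta> * L"
    and sparse: "\<And>T. T \<subseteq> {..<n} \<Longrightarrow> T \<noteq> {} \<Longrightarrow> real (card T) \<le> 2 * \<gamma> * n \<Longrightarrow>
      (\<Sum>i\<in>T. \<Sum>j\<in>T. W X i j) < \<eta> * L * card T"
    and signs: "\<And>s. s \<in> {..<n} \<rightarrow>\<^sub>E {1, -1} \<Longrightarrow> (\<Sum>i<n. \<Sum>j<n. (W X i j - M i j) * s i * s j) < K * L * n"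
  shows "sdp_solutions n {e \<in> E. X e} = {label_matrix n \<sigma>}"
proof (rule sdp_solutions_label_matrix[OF labels])
  show "n > 0" using n2 by simp
  fix x :: "nat \<Rightarrow> real"
  assume x: "(\<Sum>i<n. x i) = 0" "(\<Sum>i<n. \<sigma> i * x i) = 0" "\<exists>i<n. x i \<noteq> 0"
  have N: "(\<Sum>i<n. (x i)\<^sup>2) > 0" using x(3) by (auto intro!: sum_pos2)
  have "(\<Sum>i<n. \<Sum>j<n. W X i j * x i * x j)
      \<le> (K * L / \<gamma> + 4 * (2 * \<alpha> * k * L / n) * \<gamma> * n + 2 * (\<Delta> * L) / \<kappa> + 3 * \<kappa> * (\<eta> * L)) * (\<Sum>i<n. (x i)\<^sup>2)"
  proof (rule quadratic_form_upper_bound)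
    show "W X i j = W X j i" for i j unfolding W_def by (rule offdiag_weight_sym)
    show "0 \<le> W X i j" for i j by (simp add: W_def offdiag_weight_def)
    show "W X i i = 0" for i by (simp add: W_def offdiag_weight_def)
    show "M i i = 0" for i by (simp add: M_def both_in_def)
    show "0 < \<gamma>" "0 < \<kappa>" by fact+
    show "0 < \<eta> * L" using pos L_pos by simp
    show "0 \<le> 2 * \<alpha> * k * L / n" using \<alpha> \<beta> L_pos by simp
    show "n > 0" by fact
    show "(\<Sum>j<n. W X i j) \<le> \<Delta> * L" if "i < n" for i using deg[OF that] by simp
    show "(\<Sum>i\<in>T. \<Sum>j\<in>T. W X i j) \<le> \<eta> * L * card T" if "T \<subseteq> {..<n}" "real (card T) \<le> 2 * \<gamma> * n" for T
    proof (cases "T = {}")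
      case False
      then show ?thesis using sparse[OF that(1) _ that(2)] by simp
    qed simp
    show "(\<Sum>i<n. \<Sum>j<n. M i j * y i * y j)
        \<le> 2 * \<alpha> * k * L / n * ((\<Sum>i<n. y i)\<^sup>2 + (\<Sum>i<n. \<sigma> i * y i)\<^sup>2)" for y
      by (rule M_form_le)
    show "(\<Sum>i<n. \<Sum>j<n. (W X i j - M i j) * s i * s j) \<le> K * L * n" if s: "\<forall>i\<in>{..<n}. s i \<in> {1, -1}" for s
    proof -
      \<comment> \<open>The union bound needs finitely many sign vectors, hence extensional ones;
        only the values below \<open>n\<close> enter the form.\<close>
      have "restrict s {..<n} \<in> {..<n} \<rightarrow>\<^sub>E {1, -1}" using s by (simp add: restrict_PiE_iff)
      from signs[OF this] show ?thesis by simp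
    qed
    show "(\<sigma> i)\<^sup>2 = 1" if "i < n" for i
      using balanced_labels_sq[OF labels that] by (simp add: power2_eq_square)
  qed fact+
  also have "K * L / \<gamma> + 4 * (2 * \<alpha> * k * L / n) * \<gamma> * n + 2 * (\<Delta> * L) / \<kappa> + 3 * \<kappa> * (\<eta> * L)
      = (K / \<gamma> + 8 * \<alpha> * k * \<gamma> + 2 * \<Delta> / \<kappa> + 3 * \<kappa> * \<eta>) * L"
    using \<open>n > 0\<close> by (simp add: distrib_right)
  also have "\<dots> * (\<Sum>i<n. (x i)\<^sup>2) < \<epsilon> * L * (\<Sum>i<n. (x i)\<^sup>2)"
    using budget L_pos N by (intro mult_strict_right_mono)
  also have "\<dots> = (\<Sum>i<n. \<epsilon> * L * (x i)\<^sup>2)" by (simp add: sum_distrib_left)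
  also have "\<dots> \<le> (\<Sum>i<n. (\<Sum>j<n. W X i j * \<sigma> i * \<sigma> j) * (x i)\<^sup>2)"
    by (intro sum_mono mult_right_mono less_imp_le[OF signed]) auto
  finally show "(\<Sum>i<n. \<Sum>j<n. offdiag_weight {e \<in> E. X e} i j * x i * x j)
      < (\<Sum>i<n. (\<Sum>j<n. offdiag_weight {e \<in> E. X e} i j * \<sigma> i * \<sigma> j) * (x i)\<^sup>2)"
    unfolding W_def .
qed

lemma failure_probability:
  fixes \<epsilon> \<gamma> \<eta> \<kappa> K t \<theta> :: real
  defines "rate \<equiv> \<beta> * real (k - 1) * (t / real (n - 1) + t\<^sup>2)
        - (\<alpha> - \<beta>) * (Nmono / N1) * (t * real (k - 1) - (t * real (k - 1))\<^sup>2 / 2) + t * \<epsilon>"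
  assumes pos: "0 < \<gamma>" "0 < \<eta>" "0 < \<kappa>"
    and budget: "K / \<gamma> + 8 * \<alpha> * k * \<gamma> + 2 * (\<alpha> * exp k + 2) / \<kappa> + 3 * \<kappa> * \<eta> < \<epsilon>"
    and small: "16 * \<alpha> * k * \<gamma> / \<eta> * exp (4 * real k ^ 2 / \<eta>) \<le> 1"
    and t: "0 < t" "t * real (k - 1) \<le> 1"
    and \<theta>: "0 < \<theta>" "\<theta> * k ^ 2 \<le> 1"
  shows "measure_pmf.prob \<mu> {X. sdp_solutions n {e \<in> E. X e} \<noteq> {label_matrix n \<sigma>}}
    \<le> n * exp (L * rate) + n * exp (- 2 * L) + (exp (n * exp (- 3 * L)) - 1)
      + 2 ^ n * exp (n * L * (\<alpha> * \<theta>\<^sup>2 * k ^ 4 - \<theta> * K))"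
proof -
  define \<T> where "\<T> = {T. T \<subseteq> {..<n} \<and> T \<noteq> {} \<and> real (card T) \<le> 2 * \<gamma> * n}"
  define \<S> where "\<S> = ({..<n} \<rightarrow>\<^sub>E {1, -1 :: real})"
  define A where "A = (\<lambda>i. {X. (\<Sum>j<n. W X i j * \<sigma> i * \<sigma> j) \<le> \<epsilon> * L})"
  define B where "B = (\<lambda>i. {X. (\<alpha> * exp k + 2) * L \<le> (\<Sum>j<n. W X i j)})"
  define C where "C = (\<lambda>T. {X. \<eta> * L * card T \<le> (\<Sum>i\<in>T. \<Sum>j\<in>T. W X i j)})"
  define D where "D = (\<lambda>s. {X. K * L * n \<le> (\<Sum>i<n. \<Sum>j<n. (W X i j - M i j) * s i * s j)})"
  have fin: "finite \<T>" "finite \<S>"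
    by (auto simp: \<T>_def \<S>_def intro!: finite_PiE)
  have "{X. sdp_solutions n {e \<in> E. X e} \<noteq> {label_matrix n \<sigma>}}
      \<subseteq> (\<Union>i\<in>{..<n}. A i) \<union> (\<Union>i\<in>{..<n}. B i) \<union> (\<Union>T\<in>\<T>. C T) \<union> (\<Union>s\<in>\<S>. D s)"
  proof
    fix X assume fail: "X \<in> {X. sdp_solutions n {e \<in> E. X e} \<noteq> {label_matrix n \<sigma>}}"
    show "X \<in> (\<Union>i\<in>{..<n}. A i) \<union> (\<Union>i\<in>{..<n}. B i) \<union> (\<Union>T\<in>\<T>. C T) \<union> (\<Union>s\<in>\<S>. D s)"
    proof (rule ccontr)
      assume good: "\<not> ?thesis"
      have "sdp_solutions n {e \<in> E. X e} = {label_matrix n \<sigma>}"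
      proof (rule sdp_recovers_labels[OF pos budget])
        show "(\<Sum>j<n. W X i j * \<sigma> i * \<sigma> j) > \<epsilon> * L" if "i < n" for i
          using good that by (auto simp: A_def not_le)
        show "(\<Sum>j<n. W X i j) < (\<alpha> * exp k + 2) * L" if "i < n" for i
          using good that by (auto simp: B_def not_le)
        show "(\<Sum>i\<in>T. \<Sum>j\<in>T. W X i j) < \<eta> * L * card T"
          if "T \<subseteq> {..<n}" "T \<noteq> {}" "real (card T) \<le> 2 * \<gamma> * n" for T
        proof -
          have "T \<in> \<T>" using that by (simp add: \<T>_def)
          then have "X \<notin> C T" using good by blast
          then show ?thesis by (simp add: C_def not_le)
        qed
        show "(\<Sum>i<n. \<Sum>j<n. (W X i j - M i j) * s i * s j) < K * L * n" if "s \<in> {..<n} \<rightarrow>\<^sub>E {1, -1}" for s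
        proof -
          have "s \<in> \<S>" using that by (simp add: \<S>_def)
          then have "X \<notin> D s" using good by blast
          then show ?thesis by (simp add: D_def not_le)
        qed
      qed
      then show False using fail by simp
    qed
  qed
  then have "measure_pmf.prob \<mu> {X. sdp_solutions n {e \<in> E. X e} \<noteq> {label_matrix n \<sigma>}}
      \<le> measure_pmf.prob \<mu> ((\<Union>i\<in>{..<n}. A i) \<union> (\<Union>i\<in>{..<n}. B i) \<union> (\<Union>T\<in>\<T>. C T) \<union> (\<Union>s\<in>\<S>. D s))"
    by (intro measure_pmf.finite_measure_mono) auto
  also have "\<dots> \<le> measure_pmf.prob \<mu> (\<Union>i\<in>{..<n}. A i) + measure_pmf.prob \<mu> (\<Union>i\<in>{..<n}. B i)
      + measure_pmf.prob \<mu> (\<Union>T\<in>\<T>. C T) + measure_pmf.prob \<mu> (\<Union>s\<in>\<S>. D s)"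
    by (intro order_trans[OF measure_Un_le] add_mono order_refl) auto
  also have "measure_pmf.prob \<mu> (\<Union>i\<in>{..<n}. A i) \<le> n * exp (L * rate)"
  proof -
    have "measure_pmf.prob \<mu> (\<Union>i\<in>{..<n}. A i) \<le> (\<Sum>i<n. measure_pmf.prob \<mu> (A i))"
      by (intro measure_pmf.finite_measure_subadditive_finite) auto
    also have "\<dots> \<le> (\<Sum>i<n. exp (L * rate))"
      unfolding A_def rate_def by (intro sum_mono signed_degree_tail t) auto
    finally show ?thesis by simp
  qed
  also have "measure_pmf.prob \<mu> (\<Union>i\<in>{..<n}. B i) \<le> n * exp (- 2 * L)"
  proof -
    have "measure_pmf.prob \<mu> (\<Union>i\<in>{..<n}. B i) \<le> (\<Sum>i<n. measure_pmf.prob \<mu> (B i))"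
      by (intro measure_pmf.finite_measure_subadditive_finite) auto
    also have "\<dots> \<le> (\<Sum>i<n. exp (- 2 * L))"
      unfolding B_def by (intro sum_mono degree_tail) auto
    finally show ?thesis by simp
  qed
  also have "measure_pmf.prob \<mu> (\<Union>T\<in>\<T>. C T) \<le> exp (n * exp (- 3 * L)) - 1"
  proof -
    have "measure_pmf.prob \<mu> (\<Union>T\<in>\<T>. C T) \<le> (\<Sum>T\<in>\<T>. measure_pmf.prob \<mu> (C T))"
      using fin by (intro measure_pmf.finite_measure_subadditive_finite) auto
    also have "\<dots> \<le> (\<Sum>T\<in>\<T>. exp (- 3 * L) ^ card T)"
    proof (rule sum_mono)
      fix T assume "T \<in> \<T>"
      then have "measure_pmf.prob \<mu> (C T) \<le> exp (- 3 * L * card T)"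
        unfolding C_def by (intro sparse_tail[OF _ _ pos(2) small]) (auto simp: \<T>_def)
      then show "measure_pmf.prob \<mu> (C T) \<le> exp (- 3 * L) ^ card T"
        by (simp add: mult.commute flip: exp_of_nat_mult)
    qed
    also have "\<dots> \<le> (\<Sum>T\<in>Pow {..<n} - {{}}. exp (- 3 * L) ^ card T)"
      by (intro sum_mono2) (auto simp: \<T>_def)
    \<comment> \<open>Over all nonempty sets the sum is a binomial expansion, so the sets need not
      be counted by size.\<close>
    also have "\<dots> = (1 + exp (- 3 * L)) ^ n - 1"
      using prod_add[of "{..<n}" "\<lambda>_. exp (- 3 * L)" "\<lambda>_. 1"] by (simp add: sum_diff1 add.commute)
    also have "(1 + exp (- 3 * L)) ^ n \<le> exp (exp (- 3 * L)) ^ n"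
      by (intro power_mono exp_ge_add_one_self) (auto intro: add_nonneg_nonneg)
    also have "\<dots> = exp (n * exp (- 3 * L))" by (simp add: exp_of_nat_mult)
    finally show ?thesis by simp
  qed
  also have "measure_pmf.prob \<mu> (\<Union>s\<in>\<S>. D s) \<le> 2 ^ n * exp (n * L * (\<alpha> * \<theta>\<^sup>2 * k ^ 4 - \<theta> * K))"
  proof -
    have "measure_pmf.prob \<mu> (\<Union>s\<in>\<S>. D s) \<le> (\<Sum>s\<in>\<S>. measure_pmf.prob \<mu> (D s))"
      using fin by (intro measure_pmf.finite_measure_subadditive_finite) auto
    also have "\<dots> \<le> (\<Sum>s\<in>\<S>. exp (n * L * (\<alpha> * \<theta>\<^sup>2 * k ^ 4 - \<theta> * K)))"
    proof (rule sum_mono)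
      fix s assume "s \<in> \<S>"
      then have "\<forall>i\<in>{..<n}. s i \<in> {1, -1}" unfolding \<S>_def by (blast dest: PiE_mem)
      then show "measure_pmf.prob \<mu> (D s) \<le> exp (n * L * (\<alpha> * \<theta>\<^sup>2 * k ^ 4 - \<theta> * K))"
        unfolding D_def by (rule sign_tail[OF _ \<theta>])
    qed
    also have "\<dots> = 2 ^ n * exp (n * L * (\<alpha> * \<theta>\<^sup>2 * k ^ 4 - \<theta> * K))"
      by (simp add: \<S>_def card_PiE)
    finally show ?thesis .
  qed
  finally show ?thesis by simp
qed

end

section \<open>Averaging over the labels\<close>

lemma balanced_labels_finite: "finite (balanced_labels n)"
  by (rule finite_subset[of _ "{..<n} \<rightarrow>\<^sub>E {1, -1}"]) (auto simp: balanced_labels_def intro!: finite_PiE)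

lemma balanced_labels_nonempty:
  assumes "even n"
  shows "balanced_labels n \<noteq> {}"
proof -
  define \<sigma> where "\<sigma> = restrict (\<lambda>i. if i < n div 2 then 1 else -1 :: real) {..<n}"
  have "{i \<in> {..<n}. \<sigma> i = 1} = {..<n div 2}" by (auto simp: \<sigma>_def split: if_splits)
  moreover have "{i \<in> {..<n}. \<sigma> i = -1} = {n div 2..<n}" by (auto simp: \<sigma>_def split: if_splits)
  moreover have "n - n div 2 = n div 2" using assms by auto
  ultimately have "\<sigma> \<in> balanced_labels n"
    by (simp add: balanced_labels_def \<sigma>_def)
  then show ?thesis by blast
qed

text \<open>A failure bound uniform in the labels survives averaging over them. Evenness of
  \<open>n\<close> makes the set of balanced labels nonempty, so that \<open>pmf_of_set\<close> is
  the uniform distribution on it.\<close>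

lemma HSBM_prob_ge:
  fixes \<delta> :: real
  assumes "even n" and le: "\<And>\<sigma>. \<sigma> \<in> balanced_labels n \<Longrightarrow>
      measure_pmf.prob (Pi_pmf (nsets {..<n} k) False (\<lambda>e. bernoulli_pmf (if monochromatic \<sigma> e then p else q)))
        {X. \<not> P \<sigma> {e \<in> nsets {..<n} k. X e}} \<le> \<delta>"
  shows "1 - \<delta> \<le> measure_pmf.prob (HSBM n p q k) {(\<sigma>, H). P \<sigma> H}"
proof -
  define \<nu> where "\<nu> = (\<lambda>\<sigma>. Pi_pmf (nsets {..<n} k) False (\<lambda>e. bernoulli_pmf (if monochromatic \<sigma> e then p else q)))"
  have ne: "balanced_labels n \<noteq> {}" "finite (balanced_labels n)"
    using balanced_labels_nonempty[OF assms(1)] balanced_labels_finite by auto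
  then obtain \<sigma>\<^sub>0 where "\<sigma>\<^sub>0 \<in> balanced_labels n" by blast
  then have \<delta>: "\<delta> \<ge> 0" using le[of \<sigma>\<^sub>0] measure_nonneg order_trans by blast
  have "emeasure (HSBM n p q k) (- {(\<sigma>, H). P \<sigma> H})
      = (\<integral>\<^sup>+\<sigma>. emeasure (\<nu> \<sigma>) {X. \<not> P \<sigma> {e \<in> nsets {..<n} k. X e}} \<partial>pmf_of_set (balanced_labels n))"
    by (simp add: HSBM_def \<nu>_def vimage_def)
  also have "\<dots> \<le> (\<integral>\<^sup>+\<sigma>. ennreal \<delta> \<partial>pmf_of_set (balanced_labels n))"
  proof (intro nn_integral_mono_AE AE_pmfI)
    fix \<sigma> assume "\<sigma> \<in> set_pmf (pmf_of_set (balanced_labels n))"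
    then have "\<sigma> \<in> balanced_labels n" using ne by simp
    then show "emeasure (\<nu> \<sigma>) {X. \<not> P \<sigma> {e \<in> nsets {..<n} k. X e}} \<le> ennreal \<delta>"
      unfolding measure_pmf.emeasure_eq_measure \<nu>_def by (intro ennreal_leI le)
  qed
  also have "\<dots> = ennreal \<delta>" by simp
  finally have "measure_pmf.prob (HSBM n p q k) (- {(\<sigma>, H). P \<sigma> H}) \<le> \<delta>"
    using \<delta> by (simp add: measure_pmf.emeasure_eq_measure)
  then show ?thesis
    using measure_pmf.prob_compl[of "{(\<sigma>, H). P \<sigma> H}" "HSBM n p q k"] by (simp add: Compl_eq_Diff_UNIV)
qed

section \<open>Asymptotics\<close>

abbreviation (input) at_even :: "nat filter" where
  "at_even \<equiv> inf sequentially (principal {n. even n})"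

text \<open>The binomial coefficient grows at least linearly in \<open>n\<close> and outgrows the
  logarithm. For such \<open>n\<close> the parameters of \<open>bernoulli_pmf\<close> are not
  clamped.\<close>

lemma edge_prob_eventually_le_1:
  assumes "k \<ge> 2"
  shows "\<forall>\<^sub>F n in sequentially. edge_prob n k a \<le> 1"
proof -
  have "\<forall>\<^sub>F n in sequentially. a * ln (real n) \<le> (real n - 1) / (real k - 1)"
    using assms by real_asymp
  moreover have "\<forall>\<^sub>F n in sequentially. n > k" by (rule eventually_gt_at_top)
  ultimately show ?thesis
  proof eventually_elim
    case (elim n)
    have "(real n - 1) / (real k - 1) = (real (n - 1) / real (k - 1)) ^ 1"
      using elim assms by (simp add: of_nat_diff)
    also have "\<dots> \<le> (real (n - 1) / real (k - 1)) ^ (k - 1)"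
      using elim assms by (intro power_increasing) (auto simp: field_simps)
    also have "\<dots> \<le> real ((n - 1) choose (k - 1))"
      using elim by (intro binomial_ge_n_over_k_pow_k) auto
    finally have "a * ln (real n) \<le> real ((n - 1) choose (k - 1))" using elim by linarith
    moreover have "(n - 1) choose (k - 1) > 0" using elim by simp
    ultimately show ?case by (simp add: edge_prob_def)
  qed
qed

text \<open>The ratio is a product of \<open>m\<close> factors tending to 1/2: in the limit, each
  further vertex of a hyperedge falls into the class of a given one with probability 1/2.\<close>

lemma monochromatic_ratio_tendsto:
  "((\<lambda>n. real ((n div 2 - 1) choose m) / real ((n - 1) choose m)) \<longlongrightarrow> 1 / 2 ^ m) at_even"
proof -
  have "((\<lambda>n. \<Prod>i<m. (real n / 2 - 1 - real i) / (real n - 1 - real i)) \<longlongrightarrow> (\<Prod>i<m. 1 / 2)) sequentially"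
    by (intro tendsto_prod) real_asymp
  then have "((\<lambda>n. \<Prod>i<m. (real n / 2 - 1 - real i) / (real n - 1 - real i)) \<longlongrightarrow> 1 / 2 ^ m) at_even"
    by (intro tendsto_mono[OF inf_le1]) (simp add: power_one_over)
  moreover have "\<forall>\<^sub>F n in at_even. (\<Prod>i<m. (real n / 2 - 1 - real i) / (real n - 1 - real i))
      = real ((n div 2 - 1) choose m) / real ((n - 1) choose m)"
    unfolding eventually_inf_principal
    using eventually_gt_at_top[of "2 * m + 2"]
  proof eventually_elim
    case (elim n)
    show ?case
    proof
      assume "n \<in> {n. even n}"
      then have half: "real (n div 2) = real n / 2" by (simp add: real_of_nat_div)
      have "real ((n div 2 - 1) choose m) / real ((n - 1) choose m)
          = (\<Prod>i<m. real (n div 2 - 1 - i) / real (m - i)) / (\<Prod>i<m. real (n - 1 - i) / real (m - i))"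
        using elim binomial_altdef_of_nat[of m "n div 2 - 1", where 'a = real]
          binomial_altdef_of_nat[of m "n - 1", where 'a = real]
        by (simp add: atLeast0LessThan)
      also have "\<dots> = (\<Prod>i<m. (real (n div 2 - 1 - i) / real (m - i)) / (real (n - 1 - i) / real (m - i)))"
        by (rule prod_dividef[symmetric])
      also have "\<dots> = (\<Prod>i<m. (real n / 2 - 1 - real i) / (real n - 1 - real i))"
      proof (intro prod.cong refl)
        fix i assume i: "i \<in> {..<m}"
        have "real (n div 2 - 1 - i) = real n / 2 - 1 - real i" "real (n - 1 - i) = real n - 1 - real i"
          using i elim half by (simp_all add: of_nat_diff)
        then show "(real (n div 2 - 1 - i) / real (m - i)) / (real (n - 1 - i) / real (m - i))
            = (real n / 2 - 1 - real i) / (real n - 1 - real i)"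
          using i by simp
      qed
      finally show "(\<Prod>i<m. (real n / 2 - 1 - real i) / (real n - 1 - real i))
          = real ((n div 2 - 1) choose m) / real ((n - 1) choose m)" ..
    qed
  qed
  ultimately show ?thesis by (simp cong: tendsto_cong)
qed

text \<open>The right-hand side is the exponent obtained from the quadratic Chernoff bound for the signed
  degrees at the optimal \<open>t = g / (g m + 2 \<beta>)\<close>.\<close>

lemma I_sdp_le_chernoff_exponent:
  assumes "k \<ge> 2" "\<alpha> > \<beta>" "\<beta> > 0"
  defines "m \<equiv> real (k - 1)" and "g \<equiv> (\<alpha> - \<beta>) / 2 ^ (k - 1)"
  shows "I_sdp k \<alpha> \<beta> \<le> m * g\<^sup>2 / (2 * (g * m + 2 * \<beta>))"
proof -
  have g: "g > 0" "\<alpha> - \<beta> = g * 2 ^ (k - 1)" using assms by (simp_all add: g_def)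
  have m: "m > 0" "m = real k - 1" using assms by (simp_all add: m_def of_nat_diff)
  have pow: "(2::real) ^ k = 2 * 2 ^ (k - 1)" using assms(1) by (cases k) auto
  define r where "r = (2::real) ^ (k - 1)"
  have r: "r > 0" by (simp add: r_def)
  have "I_sdp k \<alpha> \<beta> = m / (2 * r)\<^sup>2 * ((g * r)\<^sup>2 / (\<beta> + real k / (2 * r) * (g * r)))"
  proof -
    have "real k / 2 ^ k * \<alpha> + (1 - real k / 2 ^ k) * \<beta> = \<beta> + real k / 2 ^ k * (\<alpha> - \<beta>)"
      by (simp add: algebra_simps diff_divide_distrib)
    moreover have "(2::real) ^ (2 * k) = (2 * r)\<^sup>2"
      unfolding r_def pow[symmetric] by (rule power_even_eq)
    ultimately show ?thesis unfolding I_sdp_def g(2) m(2) pow r_def by simp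
  qed
  also have "\<dots> = m * g\<^sup>2 / (2 * (g * real k + 2 * \<beta>))"
    using r by (simp add: field_simps power2_eq_square)
  \<comment> \<open>The only loss: \<open>k\<close> is replaced by the smaller \<open>k - 1\<close>
    in the denominator, so the exponent actually reached is slightly larger than
    \<open>I_sdp\<close>.\<close>
  also have "\<dots> \<le> m * g\<^sup>2 / (2 * (g * m + 2 * \<beta>))"
  proof (rule divide_left_mono)
    have "g * m \<le> g * real k" using g(1) unfolding m(2) by simp
    moreover have "0 < g * m" using g(1) m(1) by simp
    ultimately show "2 * (g * m + 2 * \<beta>) \<le> 2 * (g * real k + 2 * \<beta>)"
        "0 < 2 * (g * real k + 2 * \<beta>) * (2 * (g * m + 2 * \<beta>))"
      using assms(3) by simp_all
    show "0 \<le> m * g\<^sup>2" using m(1) by simp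
  qed
  finally show ?thesis .
qed

theorem theorem2:
  fixes k :: nat and \<alpha> \<beta> :: real
  assumes "k \<ge> 2" and "\<alpha> > \<beta>" and "\<beta> > 0"
    and "I_sdp k \<alpha> \<beta> > 1"
  shows "((\<lambda>n. measure_pmf.prob (HSBM n (edge_prob n k \<alpha>) (edge_prob n k \<beta>) k)
            {(\<sigma>, H). sdp_solutions n H = {label_matrix n \<sigma>}}) \<longlongrightarrow> 1)
         (inf sequentially (principal {n. even n}))"
proof -
  have \<alpha>: "\<alpha> > 0" using assms by simp
  define m where "m = real (k - 1)"
  define g where "g = (\<alpha> - \<beta>) / 2 ^ (k - 1)"
  define t where "t = g / (g * m + 2 * \<beta>)"
  define J where "J = m * g\<^sup>2 / (2 * (g * m + 2 * \<beta>))"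
  \<comment> \<open>The excess of \<open>J\<close> over 1 is \<open>2 * \<delta>\<close>. Demanding
    signed degrees above \<open>\<epsilon> * L\<close> rather than above 0 adds
    \<open>t * \<epsilon>\<close> to the rate, which is set to \<open>\<delta> / 2\<close>.\<close>
  define \<delta> where "\<delta> = (J - 1) / 2"
  define \<epsilon> where "\<epsilon> = \<delta> / (2 * t)"
  have g: "g > 0" and m: "m > 0" using assms by (simp_all add: g_def m_def)
  have den: "g * m + 2 * \<beta> > 0" using g m assms by (simp add: add_pos_pos)
  have t: "t > 0" "t * m \<le> 1" using g m den assms by (simp_all add: t_def field_simps)
  have J: "J > 1" using I_sdp_le_chernoff_exponent[OF assms(1-3)] assms(4) unfolding J_def m_def g_def by linarith
  have \<delta>: "\<delta> > 0" using J by (simp add: \<delta>_def)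
  have \<epsilon>: "\<epsilon> > 0" "t * \<epsilon> = \<delta> / 2" using t \<delta> by (simp_all add: \<epsilon>_def)

  \<comment> \<open>\<open>\<kappa>\<close>, \<open>\<eta>\<close>, the first entry of
    \<open>\<gamma>\<close> and \<open>K\<close> make each of the four budget terms at most
    \<open>\<epsilon> / 8\<close>; the second entry of \<open>\<gamma>\<close> gives the hypothesis
    \<open>small\<close>, and \<open>\<theta>\<close> makes the quadratic term for sign vectors at
    most half of the linear one.\<close>
  define \<Delta> where "\<Delta> = \<alpha> * exp (real k) + 2"
  define \<kappa> where "\<kappa> = 16 * \<Delta> / \<epsilon>"
  define \<eta> where "\<eta> = \<epsilon> / (24 * \<kappa>)"
  define \<gamma> where "\<gamma> = min (\<epsilon> / (64 * \<alpha> * k)) (\<eta> / (16 * \<alpha> * k * exp (4 * real k ^ 2 / \<eta>)))"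
  define K where "K = \<epsilon> * \<gamma> / 8"
  define \<theta> where "\<theta> = min (1 / real k ^ 2) (K / (2 * \<alpha> * real k ^ 4))"
  have k0: "real k > 0" using assms(1) by simp
  have \<Delta>: "\<Delta> > 0" using \<alpha> by (simp add: \<Delta>_def add_pos_pos)
  have \<kappa>: "\<kappa> > 0" using \<Delta> \<epsilon> by (simp add: \<kappa>_def)
  have \<eta>: "\<eta> > 0" using \<kappa> \<epsilon> by (simp add: \<eta>_def)
  have \<gamma>: "\<gamma> > 0" using \<epsilon> \<eta> \<alpha> k0 by (simp add: \<gamma>_def)
  have K: "K > 0" using \<epsilon> \<gamma> by (simp add: K_def)
  have \<theta>: "\<theta> > 0" using K \<alpha> k0 by (simp add: \<theta>_def)
  have budget: "K / \<gamma> + 8 * \<alpha> * k * \<gamma> + 2 * \<Delta> / \<kappa> + 3 * \<kappa> * \<eta> < \<epsilon>"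
  proof -
    have "K / \<gamma> = \<epsilon> / 8" using \<gamma> by (simp add: K_def)
    moreover have "8 * \<alpha> * k * \<gamma> \<le> 8 * \<alpha> * k * (\<epsilon> / (64 * \<alpha> * k))"
      using \<alpha> by (intro mult_left_mono) (auto simp: \<gamma>_def)
    moreover have "8 * \<alpha> * k * (\<epsilon> / (64 * \<alpha> * k)) = \<epsilon> / 8" using \<alpha> k0 by simp
    moreover have "2 * \<Delta> / \<kappa> = \<epsilon> / 8" using \<Delta> by (simp add: \<kappa>_def)
    moreover have "3 * \<kappa> * \<eta> = \<epsilon> / 8" using \<kappa> by (simp add: \<eta>_def)
    ultimately show ?thesis using \<epsilon>(1) by linarith
  qed
  have small: "16 * \<alpha> * k * \<gamma> / \<eta> * exp (4 * real k ^ 2 / \<eta>) \<le> 1"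
  proof -
    have "\<gamma> \<le> \<eta> / (16 * \<alpha> * k * exp (4 * real k ^ 2 / \<eta>))" by (simp add: \<gamma>_def)
    then have "\<gamma> * (16 * \<alpha> * k * exp (4 * real k ^ 2 / \<eta>)) \<le> \<eta>"
      using \<alpha> k0 by (simp add: pos_le_divide_eq)
    then show ?thesis using \<eta> by (simp add: mult_ac pos_divide_le_eq)
  qed
  have \<theta>_k: "\<theta> * real (k ^ 2) \<le> 1"
  proof -
    have "\<theta> \<le> 1 / real k ^ 2" by (simp add: \<theta>_def)
    then show ?thesis using k0 by (simp add: pos_le_divide_eq)
  qed
  define c where "c = \<theta> * K / 2"
  have c: "c > 0" using \<theta> K by (simp add: c_def)
  have sign_rate: "\<alpha> * \<theta>\<^sup>2 * real k ^ 4 - \<theta> * K \<le> - c"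
  proof -
    have "\<theta> \<le> K / (2 * \<alpha> * real k ^ 4)" by (simp add: \<theta>_def)
    then have "\<theta> * (2 * \<alpha> * real k ^ 4) \<le> K" using \<alpha> k0 by (simp add: pos_le_divide_eq)
    then have "\<theta> * (\<theta> * (2 * \<alpha> * real k ^ 4)) \<le> \<theta> * K" using \<theta> by (intro mult_left_mono) auto
    then show ?thesis by (simp add: c_def power2_eq_square mult_ac)
  qed

  define rate where "rate = (\<lambda>n. \<beta> * m * (t / real (n - 1) + t\<^sup>2)
        - (\<alpha> - \<beta>) * (real ((n div 2 - 1) choose (k - 1)) / real ((n - 1) choose (k - 1)))
            * (t * m - (t * m)\<^sup>2 / 2) + t * \<epsilon>)"
  have "(rate \<longlongrightarrow> \<beta> * m * (0 + t\<^sup>2) - (\<alpha> - \<beta>) * (1 / 2 ^ (k - 1)) * (t * m - (t * m)\<^sup>2 / 2) + t * \<epsilon>) at_even"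
    unfolding rate_def
  proof (intro tendsto_add tendsto_diff tendsto_mult tendsto_const monochromatic_ratio_tendsto)
    have "((\<lambda>n. t / real (n - 1)) \<longlongrightarrow> 0) sequentially" by real_asymp
    then show "((\<lambda>n. t / real (n - 1)) \<longlongrightarrow> 0) at_even" by (rule tendsto_mono[OF inf_le1])
  qed
  also have "\<beta> * m * (0 + t\<^sup>2) - (\<alpha> - \<beta>) * (1 / 2 ^ (k - 1)) * (t * m - (t * m)\<^sup>2 / 2) + t * \<epsilon> = - J + \<delta> / 2"
  proof -
    have "\<beta> * m * (0 + t\<^sup>2) - (\<alpha> - \<beta>) * (1 / 2 ^ (k - 1)) * (t * m - (t * m)\<^sup>2 / 2)
        = m * t * ((g * m + 2 * \<beta>) * t / 2 - g)"
      by (simp add: g_def power2_eq_square field_simps)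
    also have "(g * m + 2 * \<beta>) * t = g" using den by (simp add: t_def)
    also have "m * t * (g / 2 - g) = - J" by (simp add: t_def J_def power2_eq_square mult_ac)
    finally show ?thesis using \<epsilon>(2) by simp
  qed
  finally have rate_lim: "(rate \<longlongrightarrow> - J + \<delta> / 2) at_even" .
  have "- J + \<delta> / 2 < - (1 + \<delta>)" using \<delta> by (simp add: \<delta>_def field_simps)
  with rate_lim have rate_ev: "\<forall>\<^sub>F n in at_even. rate n < - (1 + \<delta>)"
    by (rule order_tendstoD(2))

  \<comment> \<open>In powers of \<open>n\<close> the summands are
    \<open>n powr (- \<delta>)\<close>, \<open>1 / n\<close>, roughly \<open>1 / n ^ 2\<close>, and
    \<open>2 ^ n * n powr (- c * n)\<close>.\<close>
  define err where "err = (\<lambda>n. real n * exp (- (1 + \<delta>) * ln (real n)) + real n * exp (- 2 * ln (real n))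
      + (exp (real n * exp (- 3 * ln (real n))) - 1) + 2 ^ n * exp (- c * (real n * ln (real n))))"
  have err_lim: "((\<lambda>n. 1 - err n) \<longlongrightarrow> 1) at_even"
  proof -
    have "((\<lambda>n. real n * exp (- (1 + \<delta>) * ln (real n))) \<longlongrightarrow> 0) sequentially"
      using \<delta> by real_asymp
    moreover have "((\<lambda>n. real n * exp (- 2 * ln (real n)) + (exp (real n * exp (- 3 * ln (real n))) - 1)) \<longlongrightarrow> 0) sequentially"
      by real_asymp
    moreover have "((\<lambda>n. 2 ^ n * exp (- c * (real n * ln (real n)))) \<longlongrightarrow> 0) sequentially"
      using c by real_asymp
    ultimately have "((\<lambda>n. 1 - (real n * exp (- (1 + \<delta>) * ln (real n))
        + (real n * exp (- 2 * ln (real n)) + (exp (real n * exp (- 3 * ln (real n))) - 1))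
        + 2 ^ n * exp (- c * (real n * ln (real n))))) \<longlongrightarrow> 1 - (0 + 0 + 0)) sequentially"
      by (intro tendsto_intros)
    then have "((\<lambda>n. 1 - err n) \<longlongrightarrow> 1) sequentially" by (simp add: err_def add.assoc)
    then show ?thesis by (rule tendsto_mono[OF inf_le1])
  qed

  have lower: "\<forall>\<^sub>F n in at_even. 1 - err n
      \<le> measure_pmf.prob (HSBM n (edge_prob n k \<alpha>) (edge_prob n k \<beta>) k)
          {(\<sigma>, H). sdp_solutions n H = {label_matrix n \<sigma>}}"
  proof -
    have "\<forall>\<^sub>F n in at_even. even n" by (simp add: eventually_inf_principal)
    moreover have "\<forall>\<^sub>F n in at_even. edge_prob n k \<alpha> \<le> 1"
      using edge_prob_eventually_le_1[OF assms(1)] by (rule filter_leD[OF inf_le1])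
    moreover have "\<forall>\<^sub>F n in at_even. n > k"
      using eventually_gt_at_top[of k] by (rule filter_leD[OF inf_le1])
    ultimately show ?thesis using rate_ev
    proof eventually_elim
      case (elim n)
      show ?case
      proof (rule HSBM_prob_ge[OF elim(1)])
        fix \<sigma> assume \<sigma>: "\<sigma> \<in> balanced_labels n"
        interpret hsbm_given_labels n k \<alpha> \<beta> \<sigma>
          using assms elim \<sigma> by unfold_locales auto
        have "measure_pmf.prob \<mu> {X. sdp_solutions n {e \<in> E. X e} \<noteq> {label_matrix n \<sigma>}}
            \<le> n * exp (L * rate n) + n * exp (- 2 * L) + (exp (n * exp (- 3 * L)) - 1)
              + 2 ^ n * exp (n * L * (\<alpha> * \<theta>\<^sup>2 * k ^ 4 - \<theta> * K))"
          using failure_probability[OF \<gamma> \<eta> \<kappa> budget[unfolded \<Delta>_def] small t(1) t(2)[unfolded m_def] \<theta> \<theta>_k]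
          unfolding rate_def m_def N1_def Nmono_def .
        also have "\<dots> \<le> err n"
        proof -
          have "L * rate n \<le> L * (- (1 + \<delta>))" using elim L_pos by (intro mult_left_mono) auto
          then have "n * exp (L * rate n) \<le> n * exp (- (1 + \<delta>) * L)"
            by (intro mult_left_mono) (simp_all only: exp_le_cancel_iff mult.commute of_nat_0_le_iff)
          moreover have "n * L * (\<alpha> * \<theta>\<^sup>2 * k ^ 4 - \<theta> * K) \<le> n * L * (- c)"
            using sign_rate L_pos by (intro mult_left_mono) auto
          then have "2 ^ n * exp (n * L * (\<alpha> * \<theta>\<^sup>2 * k ^ 4 - \<theta> * K)) \<le> 2 ^ n * exp (- c * (n * L))"
            by (intro mult_left_mono) (simp_all add: mult.commute)
          ultimately show ?thesis unfolding err_def L_def by linarith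
        qed
        finally show "measure_pmf.prob (Pi_pmf (nsets {..<n} k) False
              (\<lambda>e. bernoulli_pmf (if monochromatic \<sigma> e then edge_prob n k \<alpha> else edge_prob n k \<beta>)))
            {X. sdp_solutions n {e \<in> nsets {..<n} k. X e} \<noteq> {label_matrix n \<sigma>}} \<le> err n"
          unfolding \<mu>_def E_def pe_def p_def q_def .
      qed
    qed
  qed
  show ?thesis
  proof (rule tendsto_sandwich[OF lower _ err_lim tendsto_const])
    show "\<forall>\<^sub>F n in at_even. measure_pmf.prob (HSBM n (edge_prob n k \<alpha>) (edge_prob n k \<beta>) k)
          {(\<sigma>, H). sdp_solutions n H = {label_matrix n \<sigma>}} \<le> 1"
      by (simp add: measure_pmf.prob_le_1)
  qed
qed

end
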